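(* Let $h\in\mathcal{O}_M(\mathbb{R})$. Then the following properties are equivalent: (1) $M_h$ is power bounded on $\mathcal{S}(\mathbb{R})$. (1)' $\mathcal{M}_h$ is power bounded on $\mathcal{S}'(\mathbb{R})$. (2) $M_h$ is power bounded on $\mathcal{O}_M(\mathbb{R})$. (2)' $\mathcal{M}_h$ is power bounded on $\mathcal{O}_M'(\mathbb{R})$. (3) The sequence $\{h^n\}_{n\in\mathbb{N}}$ of pointwise powers of $h$ is bounded in $\mathcal{O}_M(\mathbb{R})$.
   Context: All functions are complex-valued. $\mathcal{S}(\mathbb{R})$ is the Schwartz space of $f\in C^\infty(\mathbb{R})$ with $\|f\|_n:=\sup_{x\in\mathbb{R}}\sup_{0\le i\le n}(1+x^2)^n|f^{(i)}(x)|<\infty$ for all $n\in\mathbb{N}_0$, a Fréchet space with these norms. $\mathcal{O}_M(\mathbb{R})$ is the space of all $f\in C^\infty(\mathbb{R})$ such that for every $m\in\mathbb{N}$ there is $n\in\mathbb{N}$ with $|f|_{m,n}:=\sup_{x\in\mathbb{R}}\sup_{0\le i\le m}(1+x^2)^{-n}|f^{(i)}(x)|<\infty$. Its locally convex topology is the one of $\mathrm{proj}_m\,\mathrm{ind}_n$ of the spaces normed by $|\cdot|_{m,n}$; it is generated by the norms $p_{m,v}(f)=\sup_{x\in\mathbb{R}}\sup_{0\le i\le m}|v(x)||f^{(i)}(x)|$, $m\in\mathbb{N}$, $v\in\mathcal{S}(\mathbb{R})$. $\mathcal{S}'(\mathbb{R})$ and $\mathcal{O}_M'(\mathbb{R})$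 are the strong duals of $\mathcal{S}(\mathbb{R})$ and $\mathcal{O}_M(\mathbb{R})$. For $h\in\mathcal{O}_M(\mathbb{R})$, $M_hf=hf$ is a continuous linear operator on $\mathcal{S}(\mathbb{R})$ and on $\mathcal{O}_M(\mathbb{R})$; $\mathcal{M}_h:=M_h'$, $S\mapsto hS$, denotes its transpose, acting on $\mathcal{S}'(\mathbb{R})$, resp. on $\mathcal{O}_M'(\mathbb{R})$. A continuous linear operator $T$ on a locally convex Hausdorff space $E$ is power bounded if $\{T^n\}_{n\in\mathbb{N}}$ is an equicontinuous subset of $\mathcal{L}(E)$, the space of continuous linear operators on $E$. *)

theory Defs
  imports "HOL-Analysis.Analysis" "HOL-Library.Function_Algebras"
begin

text \<open>
  Every vector space below is a set of complex-valued functions (of type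
  \<open>'b \<Rightarrow> complex\<close>) closed under the pointwise operations.
  A locally convex space is a topology whose topspace is such a set.
  The spaces of test functions use \<open>'b = real\<close>; their duals use
  \<open>'b = (real \<Rightarrow> complex)\<close>.  The letter \<open>\<nat>\<close> of the
  source stands for the positive integers, hence the bounds \<open>1 \<le> n\<close>.
\<close>

definition cscale :: "complex \<Rightarrow> ('b \<Rightarrow> complex) \<Rightarrow> 'b \<Rightarrow> complex" where
  "cscale c f = (\<lambda>x. c * f x)"

definition seminorm_on :: "('b \<Rightarrow> complex) set \<Rightarrow> (('b \<Rightarrow> complex) \<Rightarrow> real) \<Rightarrow> bool" where
  "seminorm_on E q \<longleftrightarrow>
     (\<forall>f\<in>E. 0 \<le> q f) \<and>
     (\<forall>f\<in>E. \<forall>g\<in>E. q (f + g) \<le> q f + q g) \<and>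
     (\<forall>c. \<forall>f\<in>E. q (cscale c f) = cmod c * q f)"

definition seminorm_topology ::
  "('b \<Rightarrow> complex) set \<Rightarrow> (('b \<Rightarrow> complex) \<Rightarrow> real) set \<Rightarrow> ('b \<Rightarrow> complex) topology" where
  "seminorm_topology E P =
     topology_generated_by {{g \<in> E. p (g - f) < e} |p f e. p \<in> P \<and> f \<in> E \<and> 0 < e}"

lemma topspace_seminorm_topology:
  assumes "P \<noteq> {}"
  shows "topspace (seminorm_topology E P) = E"
proof -
  obtain p where p: "p \<in> P" using assms by blast
  have "f \<in> {g \<in> E. p (g - f) < \<bar>p (f - f)\<bar> + 1}" if "f \<in> E" for f
    using that by auto
  moreover have "0 < \<bar>p (f - f)\<bar> + 1" for f
    by linarith
  ultimately have "E \<subseteq> \<Union>{{g \<in> E. p (g - f) < e} |p f e. p \<in> P \<and> f \<in> E \<and> 0 < e}"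
    using p by blast
  then show ?thesis
    unfolding seminorm_topology_def topology_generated_by_topspace by blast
qed

definition vbounded :: "('b \<Rightarrow> complex) topology \<Rightarrow> ('b \<Rightarrow> complex) set \<Rightarrow> bool" where
  "vbounded X B \<longleftrightarrow> B \<subseteq> topspace X \<and>
     (\<forall>U. openin X U \<and> 0 \<in> U \<longrightarrow> (\<exists>r>0. B \<subseteq> cscale (complex_of_real r) ` U))"

definition continuous_operators ::
  "('b \<Rightarrow> complex) topology \<Rightarrow> (('b \<Rightarrow> complex) \<Rightarrow> ('b \<Rightarrow> complex)) set" where
  "continuous_operators X = {T. continuous_map X X T \<and>
     (\<forall>f\<in>topspace X. \<forall>g\<in>topspace X. T (f + g) = T f + T g) \<and>
     (\<forall>c. \<forall>f\<in>topspace X. T (cscale c f) = cscale c (T f))}"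

text \<open>For families of linear maps, equicontinuity at \<open>0\<close> is equicontinuity.\<close>

definition equicontinuous_operators ::
  "('b \<Rightarrow> complex) topology \<Rightarrow> (('b \<Rightarrow> complex) \<Rightarrow> ('b \<Rightarrow> complex)) set \<Rightarrow> bool" where
  "equicontinuous_operators X H \<longleftrightarrow> H \<subseteq> continuous_operators X \<and>
     (\<forall>U. openin X U \<and> 0 \<in> U \<longrightarrow>
        (\<exists>V. openin X V \<and> 0 \<in> V \<and> (\<forall>T\<in>H. T ` V \<subseteq> U)))"

definition power_bounded ::
  "('b \<Rightarrow> complex) topology \<Rightarrow> (('b \<Rightarrow> complex) \<Rightarrow> ('b \<Rightarrow> complex)) \<Rightarrow> bool" where
  "power_bounded X T \<longleftrightarrow> T \<in> continuous_operators X \<and>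
     equicontinuous_operators X {T ^^ n |n. 1 \<le> n}"

text \<open>
  Continuous linear functionals, set to \<open>0\<close> outside the space so that each
  functional is represented by exactly one HOL function.
\<close>

definition continuous_dual :: "('b \<Rightarrow> complex) topology \<Rightarrow> (('b \<Rightarrow> complex) \<Rightarrow> complex) set" where
  "continuous_dual X = {u. continuous_map X euclidean u \<and>
     (\<forall>f\<in>topspace X. \<forall>g\<in>topspace X. u (f + g) = u f + u g) \<and>
     (\<forall>c. \<forall>f\<in>topspace X. u (cscale c f) = c * u f) \<and>
     (\<forall>f. f \<notin> topspace X \<longrightarrow> u f = 0)}"

text \<open>
  The topology of uniform convergence on bounded sets; the supremum is finite for every
  element of the dual, and the empty set is left out because \<open>Sup {}\<close> is
  unspecified on the reals.
\<close>

definition strong_dual :: "('b \<Rightarrow> complex) topology \<Rightarrow> (('b \<Rightarrow> complex) \<Rightarrow> complex) topology" where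
  "strong_dual X = seminorm_topology (continuous_dual X)
     {\<lambda>u. SUP f\<in>B. cmod (u f) |B. vbounded X B \<and> B \<noteq> {}}"

definition transpose_operator ::
  "('b \<Rightarrow> complex) topology \<Rightarrow> (('b \<Rightarrow> complex) \<Rightarrow> ('b \<Rightarrow> complex)) \<Rightarrow>
   (('b \<Rightarrow> complex) \<Rightarrow> complex) \<Rightarrow> (('b \<Rightarrow> complex) \<Rightarrow> complex)" where
  "transpose_operator X T u = (\<lambda>f. if f \<in> topspace X then u (T f) else 0)"

text \<open>
  The locally convex inductive limit of an increasing sequence of spaces \<open>A n\<close>
  normed by \<open>N n\<close>: the finest locally convex topology making all inclusions continuous
  is generated by all seminorms whose restriction to each step is continuous.
\<close>

definition lc_inductive_limit ::
  "(nat \<Rightarrow> ('b \<Rightarrow> complex) set) \<Rightarrow> (nat \<Rightarrow> ('b \<Rightarrow> complex) \<Rightarrow> real) \<Rightarrow> ('b \<Rightarrow> complex) topology" where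
  "lc_inductive_limit A N = seminorm_topology (\<Union>n\<in>{1..}. A n)
     {q. seminorm_on (\<Union>n\<in>{1..}. A n) q \<and>
         (\<forall>n\<ge>1. \<exists>C. \<forall>f\<in>A n. q f \<le> C * N n f)}"

definition nth_derivative :: "nat \<Rightarrow> (real \<Rightarrow> complex) \<Rightarrow> real \<Rightarrow> complex" where
  "nth_derivative i f = ((\<lambda>g x. vector_derivative g (at x)) ^^ i) f"

definition Ck_fun :: "nat \<Rightarrow> (real \<Rightarrow> complex) \<Rightarrow> bool" where
  "Ck_fun k f \<longleftrightarrow>
     (\<forall>i<k. \<forall>x. nth_derivative i f differentiable (at x)) \<and>
     continuous_on UNIV (nth_derivative k f)"

definition smooth_fun :: "(real \<Rightarrow> complex) \<Rightarrow> bool" where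
  "smooth_fun f \<longleftrightarrow> (\<forall>k. Ck_fun k f)"

text \<open>
  The expression \<open>\<parallel>f\<parallel>\<^sub>n\<close> is \<open>weighted_sup (\<lambda>x. (1 + x\<^sup>2) ^ n) n f\<close>, and
  \<open>|f|\<^sub>m\<^sub>,\<^sub>n\<close> is \<open>weighted_sup (\<lambda>x. 1 / (1 + x\<^sup>2) ^ n) m f\<close>.
  That the supremum is finite is the separate predicate \<open>weighted_finite\<close>.
\<close>

definition weighted_values :: "(real \<Rightarrow> real) \<Rightarrow> nat \<Rightarrow> (real \<Rightarrow> complex) \<Rightarrow> real set" where
  "weighted_values w k f = {w x * cmod (nth_derivative i f x) |x i. i \<le> k}"

definition weighted_finite :: "(real \<Rightarrow> real) \<Rightarrow> nat \<Rightarrow> (real \<Rightarrow> complex) \<Rightarrow> bool" where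
  "weighted_finite w k f \<longleftrightarrow> bdd_above (weighted_values w k f)"

definition weighted_sup :: "(real \<Rightarrow> real) \<Rightarrow> nat \<Rightarrow> (real \<Rightarrow> complex) \<Rightarrow> real" where
  "weighted_sup w k f = Sup (weighted_values w k f)"

definition schwartz_space :: "(real \<Rightarrow> complex) set" where
  "schwartz_space = {f. smooth_fun f \<and> (\<forall>n. weighted_finite (\<lambda>x. (1 + x\<^sup>2) ^ n) n f)}"

definition schwartz_topology :: "(real \<Rightarrow> complex) topology" where
  "schwartz_topology = seminorm_topology schwartz_space
     {weighted_sup (\<lambda>x. (1 + x\<^sup>2) ^ n) n |n. True}"

definition OM_space :: "(real \<Rightarrow> complex) set" where
  "OM_space = {f. smooth_fun f \<and> (\<forall>m\<ge>1. \<exists>n\<ge>1. weighted_finite (\<lambda>x. 1 / (1 + x\<^sup>2) ^ n) m f)}"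

definition OM_step :: "nat \<Rightarrow> nat \<Rightarrow> (real \<Rightarrow> complex) set" where
  "OM_step m n = {f. Ck_fun m f \<and> weighted_finite (\<lambda>x. 1 / (1 + x\<^sup>2) ^ n) m f}"

definition OM_step_limit :: "nat \<Rightarrow> (real \<Rightarrow> complex) topology" where
  "OM_step_limit m = lc_inductive_limit (OM_step m) (\<lambda>n. weighted_sup (\<lambda>x. 1 / (1 + x\<^sup>2) ^ n) m)"

text \<open>
  The projective limit topology: the coarsest topology on the intersection making all
  inclusions into the limits \<open>OM_step_limit m\<close> continuous.
\<close>

definition OM_topology :: "(real \<Rightarrow> complex) topology" where
  "OM_topology = topology_generated_by
     {OM_space \<inter> U |m U. 1 \<le> m \<and> openin (OM_step_limit m) U}"

lemma topspace_schwartz_topology: "topspace schwartz_topology = schwartz_space"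
  unfolding schwartz_topology_def by (rule topspace_seminorm_topology) blast

lemma topspace_OM_step_limit: "topspace (OM_step_limit m) = (\<Union>n\<in>{1..}. OM_step m n)"
  unfolding OM_step_limit_def lc_inductive_limit_def
proof (rule topspace_seminorm_topology)
  have "(\<lambda>_. 0) \<in> {q. seminorm_on (\<Union>n\<in>{1..}. OM_step m n) q \<and>
     (\<forall>n\<ge>1. \<exists>C. \<forall>f\<in>OM_step m n. q f \<le> C * weighted_sup (\<lambda>x. 1 / (1 + x\<^sup>2) ^ n) m f)}"
    by (auto simp: seminorm_on_def intro!: exI[of _ 0])
  then show "{q. seminorm_on (\<Union>n\<in>{1..}. OM_step m n) q \<and>
     (\<forall>n\<ge>1. \<exists>C. \<forall>f\<in>OM_step m n. q f \<le> C * weighted_sup (\<lambda>x. 1 / (1 + x\<^sup>2) ^ n) m f)} \<noteq> {}"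
    by blast
qed

lemma topspace_OM_topology: "topspace OM_topology = OM_space"
proof -
  have sub: "OM_space \<subseteq> topspace (OM_step_limit 1)"
    unfolding topspace_OM_step_limit OM_space_def OM_step_def smooth_fun_def by fastforce
  have "OM_space \<inter> topspace (OM_step_limit 1)
      \<in> {OM_space \<inter> U |m U. 1 \<le> m \<and> openin (OM_step_limit m) U}"
    by blast
  then have "OM_space \<subseteq> \<Union>{OM_space \<inter> U |m U. 1 \<le> m \<and> openin (OM_step_limit m) U}"
    using sub by blast
  then show ?thesis
    unfolding OM_topology_def topology_generated_by_topspace by blast
qed

definition mult_operator :: "(real \<Rightarrow> complex) \<Rightarrow> (real \<Rightarrow> complex) \<Rightarrow> real \<Rightarrow> complex" where
  "mult_operator h f = (\<lambda>x. h x * f x)"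

end

theory Submission
  imports Defs "HOL-Computational_Algebra.Polynomial"
begin


text \<open>
  All five properties are compared with two estimates on the powers of \<open>h\<close>:
  (a) for all \<open>m\<close> and every rapidly decreasing weight \<open>v\<close>, smooth or not,
  \<open>v |(h\<^sup>k)\<^sup>(\<^sup>i\<^sup>)|\<close> is bounded uniformly in \<open>k \<ge> 1\<close>
  and \<open>i \<le> m\<close>; (b) for every \<open>m\<close> the powers are bounded in a single step space
  with norm \<open>|\<cdot>|\<^sub>m\<^sub>,\<^sub>n\<close>.
  If the supremum over \<open>k\<close> and \<open>i\<close> outgrew all polynomials along a sequence, the
  inverse of its square root on that sequence would be a weight contradicting (a); so (a) implies (b).
  By the product rule (b) gives power boundedness on both spaces: for a continuous seminorm
  \<open>q\<close> of an inductive limit, \<open>f \<mapsto> sup\<^sub>k q (h\<^sup>k f)\<close> is again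
  one.  Power boundedness always passes to the strong dual.  Conversely, power boundedness of a
  transpose makes orbits of bounded sets bounded; applied to the functionals
  \<open>f \<mapsto> f\<^sup>(\<^sup>i\<^sup>)(x)\<close>, weighted by \<open>v x\<close> in the case of
  \<open>O\<^sub>M\<close>, and evaluated on translated Gaussians or on the constant \<open>1\<close>,
  this gives (a).
\<close>

subsection \<open>Spaces topologised by seminorms\<close>

definition csubspace :: "('b \<Rightarrow> complex) set \<Rightarrow> bool" where
  "csubspace E \<longleftrightarrow> 0 \<in> E \<and> (\<forall>f\<in>E. \<forall>g\<in>E. f + g \<in> E) \<and> (\<forall>c. \<forall>f\<in>E. cscale c f \<in> E)"

lemma cscale_minus_one: "cscale (-1) f = - f"
  by (auto simp: cscale_def fun_eq_iff)

lemma cscale_zero_left [simp]: "cscale 0 f = 0"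
  by (auto simp: cscale_def fun_eq_iff)

lemma cscale_cscale [simp]: "cscale c (cscale d f) = cscale (c * d) f"
  by (auto simp: cscale_def fun_eq_iff)

lemma cscale_one [simp]: "cscale 1 f = f"
  by (auto simp: cscale_def fun_eq_iff)

lemma csubspace_diff:
  assumes "csubspace E" "f \<in> E" "g \<in> E"
  shows "f - g \<in> E"
  using assms unfolding csubspace_def by (metis cscale_minus_one diff_conv_add_uminus)

text \<open>For homogeneity one inequality suffices: the reverse one is the same bound applied to
  \<open>cscale c f\<close> with the scalar \<open>1 / c\<close>, and for \<open>c = 0\<close> it
  follows from nonnegativity.\<close>

lemma seminorm_onI:
  assumes E: "csubspace E"
    and nonneg: "\<And>f. f \<in> E \<Longrightarrow> 0 \<le> q f"
    and triangle: "\<And>f g. f \<in> E \<Longrightarrow> g \<in> E \<Longrightarrow> q (f + g) \<le> q f + q g"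
    and scale: "\<And>c f. f \<in> E \<Longrightarrow> q (cscale c f) \<le> cmod c * q f"
  shows "seminorm_on E q"
proof -
  have "q (cscale c f) = cmod c * q f" if f: "f \<in> E" for c f
  proof (rule antisym[OF scale[OF f]])
    have cf: "cscale c f \<in> E" using E f by (simp add: csubspace_def)
    show "cmod c * q f \<le> q (cscale c f)"
    proof (cases "c = 0")
      case False
      then have "q f \<le> cmod (1 / c) * q (cscale c f)" using scale[OF cf, of "1 / c"] by simp
      then show ?thesis using False by (simp add: norm_divide field_simps)
    qed (use nonneg[OF cf] in simp)
  qed
  then show ?thesis using nonneg triangle by (simp add: seminorm_on_def)
qed

text \<open>\<open>P\<close> may fail to be directed, so neighbourhoods involve finite subfamilies
  throughout. With an empty family the generated topology would have an empty topspace. All spaces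
  of the proof, strong duals included, are instances.\<close>

locale seminormed =
  fixes E :: "('b \<Rightarrow> complex) set" and P :: "(('b \<Rightarrow> complex) \<Rightarrow> real) set"
  assumes subspace: "csubspace E"
    and nonempty: "P \<noteq> {}"
    and seminorm: "p \<in> P \<Longrightarrow> seminorm_on E p"
begin

abbreviation "X \<equiv> seminorm_topology E P"

lemma topspace_X [simp]: "topspace X = E"
  by (rule topspace_seminorm_topology[OF nonempty])

lemma zero_in: "0 \<in> E" and add_in: "f \<in> E \<Longrightarrow> g \<in> E \<Longrightarrow> f + g \<in> E"
  and scale_in: "f \<in> E \<Longrightarrow> cscale c f \<in> E" and diff_in: "f \<in> E \<Longrightarrow> g \<in> E \<Longrightarrow> f - g \<in> E"
  using subspace csubspace_diff[OF subspace] by (auto simp: csubspace_def)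

lemma nonneg: "p \<in> P \<Longrightarrow> f \<in> E \<Longrightarrow> 0 \<le> p f"
  and triangle: "p \<in> P \<Longrightarrow> f \<in> E \<Longrightarrow> g \<in> E \<Longrightarrow> p (f + g) \<le> p f + p g"
  and scale: "p \<in> P \<Longrightarrow> f \<in> E \<Longrightarrow> p (cscale c f) = cmod c * p f"
  using seminorm by (auto simp: seminorm_on_def)

lemma seminorm_zero: "p \<in> P \<Longrightarrow> p 0 = 0"
  using scale[of p 0 0] zero_in by simp

text \<open>The generating balls may be centred anywhere; the triangle inequality recentres each at
  any of its points. Intersecting two neighbourhoods unites their families and takes the smaller
  radius. An empty \<open>F\<close> stands for the whole space.\<close>

lemma openin_X:
  "openin X U \<longleftrightarrow> U \<subseteq> E \<and>
     (\<forall>f\<in>U. \<exists>F e. finite F \<and> F \<subseteq> P \<and> 0 < e \<and> {g \<in> E. \<forall>p\<in>F. p (g - f) < e} \<subseteq> U)"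
  (is "_ \<longleftrightarrow> ?R U")
proof
  assume "openin X U"
  then have "generate_topology_on {{g \<in> E. p (g - f) < e} |p f e. p \<in> P \<and> f \<in> E \<and> 0 < e} U"
    by (simp add: seminorm_topology_def openin_topology_generated_by_iff)
  then show "?R U"
  proof induction
    case (Int A B)
    show ?case
    proof (intro conjI ballI)
      fix f assume f: "f \<in> A \<inter> B"
      obtain F e where F: "finite F" "F \<subseteq> P" "0 < e" "{g \<in> E. \<forall>p\<in>F. p (g - f) < e} \<subseteq> A"
        using Int f by blast
      obtain F' e' where F': "finite F'" "F' \<subseteq> P" "0 < e'" "{g \<in> E. \<forall>p\<in>F'. p (g - f) < e'} \<subseteq> B"
        using Int f by blast
      show "\<exists>F e. finite F \<and> F \<subseteq> P \<and> 0 < e \<and> {g \<in> E. \<forall>p\<in>F. p (g - f) < e} \<subseteq> A \<inter> B"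
        using F F' by (intro exI[of _ "F \<union> F'"] exI[of _ "min e e'"]) auto
    qed (use Int in blast)
  next
    case (UN K)
    show ?case
    proof (intro conjI ballI)
      fix f assume "f \<in> \<Union>K"
      then obtain k where k: "k \<in> K" "f \<in> k" by blast
      then obtain F e where "finite F" "F \<subseteq> P" "0 < e" "{g \<in> E. \<forall>p\<in>F. p (g - f) < e} \<subseteq> k"
        using UN by meson
      with k show "\<exists>F e. finite F \<and> F \<subseteq> P \<and> 0 < e \<and> {g \<in> E. \<forall>p\<in>F. p (g - f) < e} \<subseteq> \<Union>K"
        by (intro exI[of _ F] exI[of _ e]) auto
    qed (use UN in blast)
  next
    case (Basis s)
    then obtain p f e where s: "s = {g \<in> E. p (g - f) < e}" and p: "p \<in> P" "f \<in> E" "0 < e"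
      by blast
    show ?case
    proof (intro conjI ballI)
      fix g assume g: "g \<in> s"
      have "k \<in> s" if k: "k \<in> E" "p (k - g) < e - p (g - f)" for k
        using triangle[OF p(1) diff_in[OF k(1), of g] diff_in[of g f]] k g p by (simp add: s)
      then show "\<exists>F e. finite F \<and> F \<subseteq> P \<and> 0 < e \<and> {k \<in> E. \<forall>p\<in>F. p (k - g) < e} \<subseteq> s"
        using g p by (intro exI[of _ "{p}"] exI[of _ "e - p (g - f)"]) (auto simp: s)
    qed (auto simp: s)
  qed simp
next
  assume R: "?R U"
  show "openin X U"
  proof (subst openin_subopen, intro ballI)
    fix f assume f: "f \<in> U"
    then obtain F e where F: "finite F" "F \<subseteq> P" "0 < e" "{g \<in> E. \<forall>p\<in>F. p (g - f) < e} \<subseteq> U"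
      using R by meson
    have fE: "f \<in> E" using f R by blast
    have basic: "openin X {g \<in> E. p (g - f) < e}" if "p \<in> P" for p
      unfolding seminorm_topology_def
      by (rule topology_generated_by_Basis) (use that fE F in blast)
    have "openin X {g \<in> E. \<forall>p\<in>F. p (g - f) < e}"
    proof (cases "F = {}")
      case True
      then show ?thesis using openin_topspace[of X] by simp
    next
      case False
      have "openin X (\<Inter>p\<in>F. {g \<in> E. p (g - f) < e})"
        by (rule openin_Inter) (use False F basic in auto)
      moreover have "(\<Inter>p\<in>F. {g \<in> E. p (g - f) < e}) = {g \<in> E. \<forall>p\<in>F. p (g - f) < e}"
        using False by auto
      ultimately show ?thesis by simp
    qed
    moreover have "f \<in> {g \<in> E. \<forall>p\<in>F. p (g - f) < e}"
      using F fE by (auto simp: seminorm_zero[OF subsetD])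
    ultimately show "\<exists>T. openin X T \<and> f \<in> T \<and> T \<subseteq> U"
      using F(4) by blast
  qed
qed

lemma openin_ball: "p \<in> P \<Longrightarrow> f \<in> E \<Longrightarrow> 0 < e \<Longrightarrow> openin X {g \<in> E. p (g - f) < e}"
  unfolding seminorm_topology_def by (rule topology_generated_by_Basis) blast

lemma neighbourhood_zero:
  assumes "openin X U" "0 \<in> U"
  obtains F e where "finite F" "F \<subseteq> P" "0 < e" "{g \<in> E. \<forall>p\<in>F. p g < e} \<subseteq> U"
proof -
  have "\<exists>F e. finite F \<and> F \<subseteq> P \<and> 0 < e \<and> {g \<in> E. \<forall>p\<in>F. p (g - 0) < e} \<subseteq> U"
    using assms openin_X by blast
  then show ?thesis using that by auto
qed

section \<open>Bounded sets, continuity and equicontinuity of powers\<close>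

lemma vbounded_iff: "vbounded X B \<longleftrightarrow> B \<subseteq> E \<and> (\<forall>p\<in>P. bdd_above (p ` B))"
proof (intro iffI conjI ballI)
  assume B: "vbounded X B"
  show "B \<subseteq> E" using B by (simp add: vbounded_def)
  fix p assume p: "p \<in> P"
  \<comment> \<open>The unit ball of \<open>p\<close> is a neighbourhood of 0, and the factor with
    which it absorbs \<open>B\<close> bounds \<open>p\<close> on \<open>B\<close>.\<close>
  have "openin X {g \<in> E. p g < 1}" "0 \<in> {g \<in> E. p g < 1}"
    using openin_ball[OF p zero_in, of 1] seminorm_zero[OF p] zero_in by auto
  then obtain r where r: "r > 0" "B \<subseteq> cscale (complex_of_real r) ` {g \<in> E. p g < 1}"
    using B unfolding vbounded_def by meson
  have "p f \<le> r" if "f \<in> B" for f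
  proof -
    obtain g where g: "g \<in> E" "p g < 1" "f = cscale (complex_of_real r) g" using r \<open>f \<in> B\<close> by blast
    then show ?thesis using r scale[OF p, of g "complex_of_real r"] by simp
  qed
  then show "bdd_above (p ` B)" by (auto intro: bdd_aboveI[of _ r])
next
  assume B: "B \<subseteq> E \<and> (\<forall>p\<in>P. bdd_above (p ` B))"
  show "vbounded X B"
    unfolding vbounded_def
  proof (intro conjI allI impI, simp add: B, elim conjE)
    fix U assume "openin X U" "0 \<in> U"
    then obtain F e where F: "finite F" "F \<subseteq> P" "0 < e" "{g \<in> E. \<forall>p\<in>F. p g < e} \<subseteq> U"
      by (rule neighbourhood_zero)
    obtain M where M: "\<And>p f. p \<in> P \<Longrightarrow> f \<in> B \<Longrightarrow> p f \<le> M p"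
      using B unfolding bdd_above_def by (metis imageI)
    \<comment> \<open>Finitely many seminorms, each with its own bound on \<open>B\<close>, get one
      common bound; the summand 1 makes it strict, and positive even for empty
      \<open>F\<close>.\<close>
    define C where "C = 1 + (\<Sum>p\<in>F. \<bar>M p\<bar>)"
    define r where "r = C / e"
    have C: "C > 0" unfolding C_def by (simp add: add_pos_nonneg sum_nonneg)
    have r: "r > 0" using C F r_def by simp
    have "f \<in> cscale (complex_of_real r) ` U" if f: "f \<in> B" for f
    proof -
      have fE: "f \<in> E" using f B by blast
      have "p (cscale (1 / complex_of_real r) f) < e" if p: "p \<in> F" for p
      proof -
        have "p f \<le> M p" using M F p f by blast
        also have "\<dots> \<le> \<bar>M p\<bar>" by simp
        also have "\<dots> \<le> (\<Sum>p\<in>F. \<bar>M p\<bar>)" using F p by (intro member_le_sum) auto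
        finally have "p f < C" by (simp add: C_def)
        moreover have "p (cscale (1 / complex_of_real r) f) = p f / r"
          using scale[of p f "1 / complex_of_real r"] F p fE r by (auto simp: norm_divide)
        moreover have "p f / r < e \<longleftrightarrow> p f < C"
          using C F(3) by (simp add: r_def field_simps)
        ultimately show ?thesis by simp
      qed
      then have "cscale (1 / complex_of_real r) f \<in> U" using F(4) fE scale_in by blast
      moreover have "f = cscale (complex_of_real r) (cscale (1 / complex_of_real r) f)"
        using r by simp
      ultimately show ?thesis by blast
    qed
    then show "\<exists>r>0. B \<subseteq> cscale (complex_of_real r) ` U" using r by blast
  qed
qed

lemma vbounded_subset: "vbounded X B \<Longrightarrow> B \<subseteq> E"
  and vbounded_bdd_above: "vbounded X B \<Longrightarrow> p \<in> P \<Longrightarrow> bdd_above (p ` B)"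
  by (simp_all add: vbounded_iff)

text \<open>By linearity it is enough to estimate \<open>p (T (g - f))\<close>. A neighbourhood
  involves finitely many \<open>p\<close>, so one constant \<open>K\<close> replaces all the
  \<open>C p\<close>, whatever their signs.\<close>

lemma continuous_operatorsI:
  assumes maps: "\<And>f. f \<in> E \<Longrightarrow> T f \<in> E"
    and add: "\<And>f g. f \<in> E \<Longrightarrow> g \<in> E \<Longrightarrow> T (f + g) = T f + T g"
    and scl: "\<And>c f. f \<in> E \<Longrightarrow> T (cscale c f) = cscale c (T f)"
    and bound: "\<And>p. p \<in> P \<Longrightarrow> \<exists>q\<in>P. \<exists>C. \<forall>f\<in>E. p (T f) \<le> C * q f"
  shows "T \<in> continuous_operators X"
proof -
  have diff: "T (f - g) = T f - T g" if "f \<in> E" "g \<in> E" for f g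
    using add[of "f - g" g] that diff_in by (simp add: algebra_simps)
  have "openin X {f \<in> E. T f \<in> U}" if U: "openin X U" for U
    unfolding openin_X
  proof (intro conjI ballI)
    fix f assume f: "f \<in> {f \<in> E. T f \<in> U}"
    then obtain F e where F: "finite F" "F \<subseteq> P" "0 < e" "{g \<in> E. \<forall>p\<in>F. p (g - T f) < e} \<subseteq> U"
      using U unfolding openin_X by blast
    obtain q C where q: "\<And>p. p \<in> P \<Longrightarrow> q p \<in> P" "\<And>p f. p \<in> P \<Longrightarrow> f \<in> E \<Longrightarrow> p (T f) \<le> C p * q p f"
      using bound by metis
    define K where "K = 1 + (\<Sum>p\<in>F. \<bar>C p\<bar>)"
    have K: "K > 0" unfolding K_def by (simp add: add_pos_nonneg sum_nonneg)
    have "T g \<in> U" if g: "g \<in> E" "\<forall>p\<in>q ` F. p (g - f) < e / K" for g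
    proof -
      have "p (T g - T f) < e" if p: "p \<in> F" for p
      proof -
        have pP: "p \<in> P" using p F by blast
        have gf: "g - f \<in> E" using g f diff_in by blast
        have "p (T g - T f) = p (T (g - f))" using diff g f by auto
        also have "\<dots> \<le> C p * q p (g - f)" using q(2)[OF pP gf] .
        also have "\<dots> \<le> K * q p (g - f)"
        proof (rule mult_right_mono)
          have "C p \<le> \<bar>C p\<bar>" by simp
          also have "\<dots> \<le> (\<Sum>p\<in>F. \<bar>C p\<bar>)" using F p by (intro member_le_sum) auto
          finally show "C p \<le> K" by (simp add: K_def)
        qed (use nonneg q(1) pP gf in blast)
        also have "\<dots> < K * (e / K)" using g p K by (intro mult_strict_left_mono) auto
        finally show ?thesis using K by simp
      qed
      then show ?thesis using F(4) maps g by blast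
    qed
    then show "\<exists>F e. finite F \<and> F \<subseteq> P \<and> 0 < e \<and>
        {g \<in> E. \<forall>p\<in>F. p (g - f) < e} \<subseteq> {f \<in> E. T f \<in> U}"
      using F q(1) K by (intro exI[of _ "q ` F"] exI[of _ "e / K"]) auto
  qed simp
  then have "continuous_map X X T"
    using maps by (auto simp: continuous_map_def)
  then show ?thesis
    using add scl by (simp add: continuous_operators_def)
qed

lemma funpow_in:
  assumes "\<And>f. f \<in> E \<Longrightarrow> T f \<in> E" "f \<in> E"
  shows "(T ^^ n) f \<in> E"
  by (induction n) (use assms in auto)

text \<open>The seminorm \<open>q\<close> and the constant are chosen before the exponent; this
  uniformity turns continuity of the single powers into equicontinuity.\<close>

lemma power_boundedI:
  assumes maps: "\<And>f. f \<in> E \<Longrightarrow> T f \<in> E"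
    and add: "\<And>f g. f \<in> E \<Longrightarrow> g \<in> E \<Longrightarrow> T (f + g) = T f + T g"
    and scl: "\<And>c f. f \<in> E \<Longrightarrow> T (cscale c f) = cscale c (T f)"
    and bound: "\<And>p. p \<in> P \<Longrightarrow> \<exists>q\<in>P. \<exists>C. \<forall>n\<ge>1. \<forall>f\<in>E. p ((T ^^ n) f) \<le> C * q f"
  shows "power_bounded X T"
proof -
  have maps_n: "(T ^^ n) f \<in> E" if "f \<in> E" for f n
    using funpow_in maps that by blast
  have add_n: "(T ^^ n) (f + g) = (T ^^ n) f + (T ^^ n) g" if "f \<in> E" "g \<in> E" for f g n
  proof (induction n)
    case (Suc n)
    then show ?case using add[OF maps_n[OF that(1)] maps_n[OF that(2)]] by (simp del: plus_fun_apply)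
  qed simp
  have scl_n: "(T ^^ n) (cscale c f) = cscale c ((T ^^ n) f)" if "f \<in> E" for c f n
    by (induction n) (use that scl maps_n in auto)
  have cont: "T ^^ n \<in> continuous_operators X" if "n \<ge> 1" for n
    by (rule continuous_operatorsI) (use that bound maps_n add_n scl_n in \<open>simp_all, meson\<close>)
  have equi: "\<exists>V. openin X V \<and> 0 \<in> V \<and> (\<forall>S\<in>{T ^^ n |n. 1 \<le> n}. S ` V \<subseteq> U)"
    if U: "openin X U" "0 \<in> U" for U
  proof -
    obtain F e where F: "finite F" "F \<subseteq> P" "0 < e" "{g \<in> E. \<forall>p\<in>F. p g < e} \<subseteq> U"
      using neighbourhood_zero[OF U] by blast
    obtain q C where q: "\<And>p. p \<in> P \<Longrightarrow> q p \<in> P"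
      "\<And>p n f. p \<in> P \<Longrightarrow> n \<ge> 1 \<Longrightarrow> f \<in> E \<Longrightarrow> p ((T ^^ n) f) \<le> C p * q p f"
      using bound by metis
    \<comment> \<open>The denominators \<open>1 + |C p|\<close> stay positive even if
      \<open>C p\<close> is zero or negative. The intersection with \<open>E\<close> handles empty
      \<open>F\<close>, where the remaining intersection is the universe.\<close>
    define V where "V = E \<inter> (\<Inter>p\<in>F. {g \<in> E. q p (g - 0) < e / (1 + \<bar>C p\<bar>)})"
    have "openin X V"
    proof (cases "F = {}")
      case True
      then show ?thesis using openin_topspace[of X] by (simp add: V_def)
    next
      case False
      have "openin X (\<Inter>p\<in>F. {g \<in> E. q p (g - 0) < e / (1 + \<bar>C p\<bar>)})"
        by (rule openin_Inter) (use False F q(1) openin_ball[OF _ zero_in] in \<open>auto simp del: diff_zero\<close>)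
      moreover have "openin X E" using openin_topspace[of X] by simp
      ultimately show ?thesis unfolding V_def by (rule openin_Int[rotated])
    qed
    moreover have "0 \<in> V"
    proof -
      have "q p 0 = 0" if "p \<in> F" for p
        using seminorm_zero q(1) F(2) that by blast
      moreover have "0 < e / (1 + \<bar>C p\<bar>)" for p
        using F(3) by (intro divide_pos_pos) auto
      ultimately show ?thesis using zero_in by (simp add: V_def)
    qed
    moreover have "(T ^^ n) g \<in> U" if n: "n \<ge> 1" and g: "g \<in> V" for n g
    proof -
      have gE: "g \<in> E" using g by (simp add: V_def)
      have "p ((T ^^ n) g) < e" if p: "p \<in> F" for p
      proof -
        have pP: "p \<in> P" using p F by blast
        have "p ((T ^^ n) g) \<le> C p * q p g" using q(2)[OF pP n gE] .
        also have "\<dots> \<le> (1 + \<bar>C p\<bar>) * q p g"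
          using nonneg[OF q(1)[OF pP] gE] by (intro mult_right_mono) auto
        also have "\<dots> < (1 + \<bar>C p\<bar>) * (e / (1 + \<bar>C p\<bar>))"
          using g p by (intro mult_strict_left_mono) (auto simp: V_def)
        also have "\<dots> = e"
        proof -
          have "1 + \<bar>C p\<bar> \<noteq> 0" by linarith
          then show ?thesis by simp
        qed
        finally show ?thesis .
      qed
      then show ?thesis using F(4) maps_n gE by blast
    qed
    ultimately show ?thesis by blast
  qed
  show ?thesis
    unfolding power_bounded_def equicontinuous_operators_def
    using cont cont[of 1] equi by auto
qed

section \<open>Continuous functionals, strong duals and transposes\<close>

lemma continuous_dual_bounded:
  assumes u: "u \<in> continuous_dual X" and B: "vbounded X B"
  shows "bdd_above ((\<lambda>f. cmod (u f)) ` B)"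
proof -
  \<comment> \<open>The set where \<open>u\<close> has modulus below 1 is a neighbourhood of 0,
    hence absorbs \<open>B\<close>. The resulting bound makes the suprema in
    \<open>strong_dual\<close> genuine.\<close>
  have "openin X {f \<in> topspace X. u f \<in> ball 0 1}"
    using u by (intro openin_continuous_map_preimage) (auto simp: continuous_dual_def)
  moreover have u0: "u 0 = 0"
  proof -
    have "u (cscale 0 0) = 0 * u 0"
      using u zero_in topspace_X unfolding continuous_dual_def by blast
    then show ?thesis by simp
  qed
  ultimately have "openin X {f \<in> E. cmod (u f) < 1}" "0 \<in> {f \<in> E. cmod (u f) < 1}"
    using zero_in by auto
  then obtain r where r: "r > 0" "B \<subseteq> cscale (complex_of_real r) ` {f \<in> E. cmod (u f) < 1}"
    using B unfolding vbounded_def by meson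
  have "cmod (u f) \<le> r" if "f \<in> B" for f
  proof -
    obtain g where g: "g \<in> E" "cmod (u g) < 1" "f = cscale (complex_of_real r) g" using r \<open>f \<in> B\<close> by blast
    then show ?thesis using r u by (simp add: continuous_dual_def norm_mult)
  qed
  then show ?thesis by (auto intro: bdd_aboveI[of _ r])
qed

lemma continuous_dualI:
  assumes add: "\<And>f g. f \<in> E \<Longrightarrow> g \<in> E \<Longrightarrow> u (f + g) = u f + u g"
    and scl: "\<And>c f. f \<in> E \<Longrightarrow> u (cscale c f) = c * u f"
    and outside: "\<And>f. f \<notin> E \<Longrightarrow> u f = 0"
    and p: "p \<in> P" and bound: "\<And>f. f \<in> E \<Longrightarrow> cmod (u f) \<le> C * p f"
  shows "u \<in> continuous_dual X"
proof -
  have diff: "u (f - g) = u f - u g" if "f \<in> E" "g \<in> E" for f g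
    using add[of "f - g" g] that diff_in by (simp add: algebra_simps)
  have "openin X {f \<in> E. u f \<in> U}" if U: "open U" for U
    unfolding openin_X
  proof (intro conjI ballI)
    fix f assume f: "f \<in> {f \<in> E. u f \<in> U}"
    then obtain e where e: "e > 0" "ball (u f) e \<subseteq> U"
      using U openE by blast
    have "u g \<in> U" if g: "g \<in> E" "p (g - f) < e / (1 + \<bar>C\<bar>)" for g
    proof -
      have gf: "g - f \<in> E" using g f diff_in by blast
      have C1: "1 + \<bar>C\<bar> > 0" by linarith
      have "cmod (u g - u f) = cmod (u (g - f))" using diff g f by auto
      also have "\<dots> \<le> C * p (g - f)" using bound gf .
      also have "\<dots> \<le> (1 + \<bar>C\<bar>) * p (g - f)"
        using nonneg[OF p gf] by (intro mult_right_mono) auto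
      also have "\<dots> < (1 + \<bar>C\<bar>) * (e / (1 + \<bar>C\<bar>))"
        using g C1 by (intro mult_strict_left_mono)
      finally show ?thesis using e C1 by (auto simp: dist_norm norm_minus_commute)
    qed
    moreover have "0 < e / (1 + \<bar>C\<bar>)" using e by (intro divide_pos_pos) auto
    ultimately show "\<exists>F e. finite F \<and> F \<subseteq> P \<and> 0 < e \<and>
        {g \<in> E. \<forall>p\<in>F. p (g - f) < e} \<subseteq> {f \<in> E. u f \<in> U}"
      using p by (intro exI[of _ "{p}"] exI[of _ "e / (1 + \<bar>C\<bar>)"]) auto
  qed simp
  then have "continuous_map X euclidean u"
    by (auto simp: continuous_map_def)
  then show ?thesis
    using add scl outside by (simp add: continuous_dual_def)
qed

text \<open>This makes the locale available for the dual, so that boundedness and power boundedness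
  there are handled by the same lemmas. The bounded set \<open>{0}\<close> shows that the family of
  seminorms is not empty.\<close>

lemma seminormed_strong_dual:
  "seminormed (continuous_dual X) {\<lambda>u. SUP f\<in>B. cmod (u f) |B. vbounded X B \<and> B \<noteq> {}}"
proof
  show subspace_dual: "csubspace (continuous_dual X)"
    unfolding csubspace_def
  proof (intro conjI ballI allI)
    show "0 \<in> continuous_dual X" by (auto simp: continuous_dual_def zero_fun_def)
    fix u v :: "('b \<Rightarrow> complex) \<Rightarrow> complex" and c assume u: "u \<in> continuous_dual X"
    have "continuous_map X euclidean ((\<lambda>z. c * z) \<circ> u)"
      using u by (intro continuous_map_compose[of X euclidean])
        (auto simp: continuous_dual_def intro!: continuous_intros)
    then show "cscale c u \<in> continuous_dual X"
      using u by (simp add: continuous_dual_def cscale_def[of c u] o_def algebra_simps)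
    assume v: "v \<in> continuous_dual X"
    have "continuous_map X euclidean (\<lambda>f. u f + v f)"
      using u v by (intro continuous_map_add) (auto simp: continuous_dual_def)
    then show "u + v \<in> continuous_dual X"
      using u v by (simp add: continuous_dual_def func_plus[of u v] algebra_simps)
  qed
  have "vbounded X {0}"
    using zero_in seminorm_zero by (auto simp: vbounded_iff)
  then show "{\<lambda>u. SUP f\<in>B. cmod (u f) |B. vbounded X B \<and> B \<noteq> {}} \<noteq> {}" by blast
  fix p assume "p \<in> {\<lambda>u. SUP f\<in>B. cmod (u f) |B. vbounded X B \<and> B \<noteq> {}}"
  then obtain B where p: "p = (\<lambda>u. SUP f\<in>B. cmod (u f))" and B: "vbounded X B" "B \<noteq> {}" by blast
  obtain b where b: "b \<in> B" using B by blast
  have le: "cmod (u f) \<le> p u" if "u \<in> continuous_dual X" "f \<in> B" for u f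
    unfolding p using continuous_dual_bounded[OF that(1) B(1)] that(2) by (rule cSUP_upper2) simp
  have sup_le: "p u \<le> C" if "\<And>f. f \<in> B \<Longrightarrow> cmod (u f) \<le> C" for u C
    unfolding p using B that by (intro cSUP_least) auto
  show "seminorm_on (continuous_dual X) p"
  proof (rule seminorm_onI[OF subspace_dual])
    fix u v :: "('b \<Rightarrow> complex) \<Rightarrow> complex" and c assume u: "u \<in> continuous_dual X"
    show "0 \<le> p u" using le[OF u b] norm_ge_zero order_trans by blast
    show "p (cscale c u) \<le> cmod c * p u"
      by (rule sup_le) (use le[OF u] in \<open>auto simp: cscale_def norm_mult intro!: mult_left_mono\<close>)
    assume v: "v \<in> continuous_dual X"
    show "p (u + v) \<le> p u + p v"
    proof (rule sup_le)
      fix f assume f: "f \<in> B"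
      show "cmod ((u + v) f) \<le> p u + p v"
        using norm_triangle_ineq[of "u f" "v f"] le[OF u f] le[OF v f] by simp
    qed
  qed
qed

text \<open>The induction generalises \<open>f\<close> and moves one factor \<open>T\<close> into
  the argument. Off \<open>E\<close> the transpose gives 0, so \<open>f\<close> and its iterates
  have to stay in \<open>E\<close>.\<close>

lemma transpose_operator_funpow:
  assumes "\<And>f. f \<in> E \<Longrightarrow> T f \<in> E" "f \<in> E"
  shows "(transpose_operator X T ^^ n) u f = u ((T ^^ n) f)"
  using assms(2)
proof (induction n arbitrary: f)
  case (Suc n)
  then have "(transpose_operator X T ^^ Suc n) u f = u ((T ^^ n) (T f))"
    using assms(1) by (simp add: transpose_operator_def[where u="(transpose_operator X T ^^ n) u"])
  then show ?case by (simp only: funpow_Suc_right o_apply)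
qed simp

text \<open>A neighbourhood \<open>V\<close> that all powers map into \<open>U\<close> absorbs
  \<open>B\<close> with some factor \<open>r\<close>. By linearity \<open>U\<close> absorbs every
  image of \<open>B\<close> with the same \<open>r\<close>.\<close>

lemma orbit_vbounded:
  assumes T: "power_bounded X T" and B: "vbounded X B"
  shows "vbounded X (\<Union>n\<in>{1..}. (T ^^ n) ` B)"
proof -
  have Tn: "T ^^ n \<in> continuous_operators X" if "n \<ge> 1" for n
    using T that by (auto simp: power_bounded_def equicontinuous_operators_def)
  have maps: "(T ^^ n) f \<in> E" if "n \<ge> 1" "f \<in> E" for n f
    using Tn[OF that(1)] that(2) by (auto simp: continuous_operators_def continuous_map_def)
  show ?thesis
    unfolding vbounded_def
  proof (intro conjI allI impI)
    show "(\<Union>n\<in>{1..}. (T ^^ n) ` B) \<subseteq> topspace X"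
      using B maps by (auto simp: vbounded_def)
    fix U assume U: "openin X U \<and> 0 \<in> U"
    then have "\<exists>V. openin X V \<and> 0 \<in> V \<and> (\<forall>S\<in>{T ^^ n |n. 1 \<le> n}. S ` V \<subseteq> U)"
      using T by (simp only: power_bounded_def equicontinuous_operators_def)
    then obtain V where V: "openin X V" "0 \<in> V" "\<And>n. n \<ge> 1 \<Longrightarrow> (T ^^ n) ` V \<subseteq> U"
      by blast
    then obtain r where r: "r > 0" "B \<subseteq> cscale (complex_of_real r) ` V"
      using B unfolding vbounded_def by meson
    have "(T ^^ n) f \<in> cscale (complex_of_real r) ` U" if n: "n \<ge> 1" and f: "f \<in> B" for n f
    proof -
      obtain g where g: "g \<in> V" "f = cscale (complex_of_real r) g" using r f by blast
      have "g \<in> E" using V g openin_subset by fastforce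
      then have "(T ^^ n) f = cscale (complex_of_real r) ((T ^^ n) g)"
        using Tn[OF n] g by (simp add: continuous_operators_def)
      then show ?thesis using V(3)[OF n] g by blast
    qed
    then show "\<exists>r>0. (\<Union>n\<in>{1..}. (T ^^ n) ` B) \<subseteq> cscale (complex_of_real r) ` U"
      using r by auto
  qed
qed

text \<open>Evaluating an iterated transpose on \<open>B\<close> is evaluating \<open>u\<close> on
  an image of \<open>B\<close>. All these images lie in one bounded set, the orbit of
  \<open>B\<close>, whose seminorm dominates with constant 1.\<close>

lemma power_bounded_transpose:
  assumes T: "power_bounded X T"
  shows "power_bounded (strong_dual X) (transpose_operator X T)"
proof -
  interpret D: seminormed "continuous_dual X" "{\<lambda>u. SUP f\<in>B. cmod (u f) |B. vbounded X B \<and> B \<noteq> {}}"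
    by (rule seminormed_strong_dual)
  have TX: "T \<in> continuous_operators X" using T by (simp add: power_bounded_def)
  then have maps: "T f \<in> E" if "f \<in> E" for f
    using that by (auto simp: continuous_operators_def continuous_map_def)
  show ?thesis
    unfolding strong_dual_def
  proof (rule D.power_boundedI)
    fix u v :: "('b \<Rightarrow> complex) \<Rightarrow> complex" and c
    show "transpose_operator X T (u + v) = transpose_operator X T u + transpose_operator X T v"
      by (auto simp: transpose_operator_def fun_eq_iff)
    show "transpose_operator X T (cscale c u) = cscale c (transpose_operator X T u)"
      by (auto simp: transpose_operator_def cscale_def fun_eq_iff)
    assume u: "u \<in> continuous_dual X"
    have "continuous_map X euclidean (u \<circ> T)"
      using u TX by (intro continuous_map_compose[of X X]) (auto simp: continuous_dual_def continuous_operators_def)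
    then have "continuous_map X euclidean (transpose_operator X T u)"
      by (rule continuous_map_eq) (simp add: transpose_operator_def)
    then show "transpose_operator X T u \<in> continuous_dual X"
      using u TX maps add_in scale_in
      by (simp add: continuous_dual_def continuous_operators_def transpose_operator_def)
  next
    fix p assume "p \<in> {\<lambda>u. SUP f\<in>B. cmod (u f) |B. vbounded X B \<and> B \<noteq> {}}"
    then obtain B where p: "p = (\<lambda>u. SUP f\<in>B. cmod (u f))" and B: "vbounded X B" "B \<noteq> {}" by blast
    define B' where "B' = (\<Union>n\<in>{1..}. (T ^^ n) ` B)"
    have B': "vbounded X B'" unfolding B'_def using T B(1) by (rule orbit_vbounded)
    moreover have "B' \<noteq> {}" using B by (auto simp: B'_def)
    moreover have "p ((transpose_operator X T ^^ n) u) \<le> 1 * (SUP f\<in>B'. cmod (u f))"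
      if n: "n \<ge> 1" and u: "u \<in> continuous_dual X" for n u
      unfolding p
    proof (rule cSUP_least[OF B(2)])
      fix f assume f: "f \<in> B"
      then have "f \<in> E" using B by (auto simp: vbounded_def)
      then have "cmod ((transpose_operator X T ^^ n) u f) = cmod (u ((T ^^ n) f))"
        using transpose_operator_funpow maps by metis
      also have "\<dots> \<le> (SUP f\<in>B'. cmod (u f))"
        using continuous_dual_bounded[OF u B'] n f by (intro cSUP_upper) (auto simp: B'_def)
      finally show "cmod ((transpose_operator X T ^^ n) u f) \<le> 1 * (SUP f\<in>B'. cmod (u f))" by simp
    qed
    ultimately show "\<exists>q\<in>{\<lambda>u. SUP f\<in>B. cmod (u f) |B. vbounded X B \<and> B \<noteq> {}}. \<exists>C. \<forall>n\<ge>1.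
        \<forall>u\<in>continuous_dual X. p ((transpose_operator X T ^^ n) u) \<le> C * q u"
      by (intro bexI[of _ "\<lambda>u. SUP f\<in>B'. cmod (u f)"] exI[of _ 1]) auto
  qed
qed

text \<open>\<open>D_bounded\<close> expresses that \<open>D\<close> is bounded in the strong dual.
  Its orbit under the transpose is then bounded as well, and the strong seminorm of \<open>B\<close>
  turns this into a bound on the pairings of \<open>D\<close> with the iterates of
  \<open>T\<close>.\<close>

lemma transpose_orbit_bounded:
  assumes T': "power_bounded (strong_dual X) (transpose_operator X T)"
    and maps: "\<And>f. f \<in> E \<Longrightarrow> T f \<in> E"
    and D: "D \<subseteq> continuous_dual X"
    and D_bounded: "\<And>B. vbounded X B \<Longrightarrow> \<exists>C. \<forall>u\<in>D. \<forall>f\<in>B. cmod (u f) \<le> C"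
    and B: "vbounded X B"
  shows "\<exists>C. \<forall>n\<ge>1. \<forall>u\<in>D. \<forall>f\<in>B. cmod (u ((T ^^ n) f)) \<le> C"
proof (cases "B = {}")
  \<comment> \<open>The strong seminorms range over nonempty sets only; for empty \<open>B\<close>
    the claim is vacuous.\<close>
  case False
  interpret D: seminormed "continuous_dual X" "{\<lambda>u. SUP f\<in>B. cmod (u f) |B. vbounded X B \<and> B \<noteq> {}}"
    by (rule seminormed_strong_dual)
  have "vbounded D.X D"
    unfolding D.vbounded_iff
  proof (intro conjI ballI D)
    fix p assume "p \<in> {\<lambda>u. SUP f\<in>B. cmod (u f) |B. vbounded X B \<and> B \<noteq> {}}"
    then obtain B where p: "p = (\<lambda>u. SUP f\<in>B. cmod (u f))" and B: "vbounded X B" "B \<noteq> {}" by blast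
    obtain C where "\<forall>u\<in>D. \<forall>f\<in>B. cmod (u f) \<le> C" using D_bounded B by blast
    then have "p u \<le> C" if "u \<in> D" for u
      unfolding p using that B by (intro cSUP_least) auto
    then show "bdd_above (p ` D)" by (auto intro: bdd_aboveI[of _ C])
  qed
  then have orbit: "vbounded D.X (\<Union>n\<in>{1..}. (transpose_operator X T ^^ n) ` D)"
    using T' unfolding strong_dual_def by (intro D.orbit_vbounded)
  then have "bdd_above ((\<lambda>u. SUP f\<in>B. cmod (u f)) ` (\<Union>n\<in>{1..}. (transpose_operator X T ^^ n) ` D))"
    unfolding D.vbounded_iff by (rule conjunct2[THEN bspec]) (use B False in blast)
  then obtain C where C: "\<And>n u. n \<ge> 1 \<Longrightarrow> u \<in> D \<Longrightarrow>
      (SUP f\<in>B. cmod ((transpose_operator X T ^^ n) u f)) \<le> C"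
    unfolding bdd_above_def by fastforce
  have "cmod (u ((T ^^ n) f)) \<le> C" if n: "n \<ge> 1" and u: "u \<in> D" and f: "f \<in> B" for n u f
  proof -
    have dual: "(transpose_operator X T ^^ n) u \<in> continuous_dual X"
      using orbit n u unfolding D.vbounded_iff by blast
    have "f \<in> E" using f B by (auto simp: vbounded_def)
    then have "cmod (u ((T ^^ n) f)) = cmod ((transpose_operator X T ^^ n) u f)"
      using transpose_operator_funpow maps by metis
    also have "\<dots> \<le> (SUP f\<in>B. cmod ((transpose_operator X T ^^ n) u f))"
      by (rule cSUP_upper[OF f continuous_dual_bounded[OF dual B]])
    finally show ?thesis using C[OF n u] by linarith
  qed
  then show ?thesis by blast
qed simp

end


subsection \<open>Iterated derivatives and weighted norms\<close>

lemma nth_derivative_0 [simp]: "nth_derivative 0 f = f"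
  by (simp add: nth_derivative_def)

text \<open>The definition adds derivatives on the outside; peeling off the innermost one lets
  inductions on the order pass from \<open>f\<close> to its derivative.\<close>

lemma nth_derivative_Suc_deriv:
  "nth_derivative (Suc i) f = nth_derivative i (\<lambda>x. vector_derivative f (at x))"
  unfolding nth_derivative_def funpow_Suc_right o_apply ..

lemma Ck_fun_0: "Ck_fun 0 f \<longleftrightarrow> continuous_on UNIV f"
  by (simp add: Ck_fun_def)

lemma Ck_fun_Suc:
  "Ck_fun (Suc k) f \<longleftrightarrow>
     (\<forall>x. f differentiable (at x)) \<and> Ck_fun k (\<lambda>x. vector_derivative f (at x))"
  by (auto simp: Ck_fun_def All_less_Suc2 nth_derivative_Suc_deriv)

lemma Ck_fun_SucI:
  assumes "\<And>x. (f has_vector_derivative f' x) (at x)" "Ck_fun k f'"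
  shows "Ck_fun (Suc k) f" and "nth_derivative (Suc i) f = nth_derivative i f'"
proof -
  have *: "(\<lambda>x. vector_derivative f (at x)) = f'"
    using assms(1) by (auto simp: vector_derivative_at)
  show "Ck_fun (Suc k) f" "nth_derivative (Suc i) f = nth_derivative i f'"
    using assms unfolding Ck_fun_Suc nth_derivative_Suc_deriv *
    by (auto intro: differentiableI_vector)
qed

lemma Ck_fun_SucE:
  assumes "Ck_fun (Suc k) f"
  obtains f' where "\<And>x. (f has_vector_derivative f' x) (at x)" "Ck_fun k f'"
    "\<And>i. nth_derivative (Suc i) f = nth_derivative i f'"
  using assms that[of "\<lambda>x. vector_derivative f (at x)"]
  unfolding Ck_fun_Suc nth_derivative_Suc_deriv vector_derivative_works by blast

lemma Ck_fun_mono: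
  assumes "Ck_fun k f" "j \<le> k"
  shows "Ck_fun j f"
  using assms(2,1)
proof (induction rule: inc_induct)
  case (step n)
  then have "nth_derivative n f differentiable (at x)" for x
    by (auto simp: Ck_fun_def)
  then have "continuous_on UNIV (nth_derivative n f)"
    by (simp add: continuous_at_imp_continuous_on differentiable_imp_continuous_within)
  with step show ?case by (auto simp: Ck_fun_def)
qed

lemma Ck_fun_const: "Ck_fun k (\<lambda>x. c)"
proof (induction k arbitrary: c)
  case (Suc k)
  show ?case by (rule Ck_fun_SucI(1)[where f'="\<lambda>_. 0"]) (auto intro: Suc)
qed (simp add: Ck_fun_0)

text \<open>Regularity and formula are proved in one induction, since \<open>Ck_fun_SucI\<close>
  yields the formula one order higher only for a derivative known to be regular. Beyond order
  \<open>k\<close> the operator \<open>vector_derivative\<close> may return arbitrary values, hence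
  \<open>i \<le> k\<close>.\<close>

lemma Ck_fun_add:
  assumes "Ck_fun k f" "Ck_fun k g"
  shows "Ck_fun k (\<lambda>x. f x + g x)"
    and "i \<le> k \<Longrightarrow> nth_derivative i (\<lambda>x. f x + g x) x = nth_derivative i f x + nth_derivative i g x"
proof -
  have "Ck_fun k (\<lambda>x. f x + g x) \<and> (\<forall>i\<le>k. nth_derivative i (\<lambda>x. f x + g x) =
      (\<lambda>x. nth_derivative i f x + nth_derivative i g x))"
    using assms
  proof (induction k arbitrary: f g)
    case (Suc k)
    obtain f' where f': "\<And>x. (f has_vector_derivative f' x) (at x)" "Ck_fun k f'"
      "\<And>i. nth_derivative (Suc i) f = nth_derivative i f'"
      using Ck_fun_SucE[OF Suc.prems(1)] by blast
    obtain g' where g': "\<And>x. (g has_vector_derivative g' x) (at x)" "Ck_fun k g'"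
      "\<And>i. nth_derivative (Suc i) g = nth_derivative i g'"
      using Ck_fun_SucE[OF Suc.prems(2)] by blast
    have d: "((\<lambda>x. f x + g x) has_vector_derivative f' x + g' x) (at x)" for x
      using f' g' by (intro has_vector_derivative_add)
    note IH = Suc.IH[OF f'(2) g'(2)]
    have "nth_derivative i (\<lambda>x. f x + g x) = (\<lambda>x. nth_derivative i f x + nth_derivative i g x)"
      if "i \<le> Suc k" for i
      using that IH f'(3) g'(3) Ck_fun_SucI(2)[OF d] by (cases i) auto
    then show ?case using Ck_fun_SucI(1)[OF d] IH by blast
  qed (auto simp: Ck_fun_0 intro: continuous_on_add)
  then show "Ck_fun k (\<lambda>x. f x + g x)"
    "i \<le> k \<Longrightarrow> nth_derivative i (\<lambda>x. f x + g x) x = nth_derivative i f x + nth_derivative i g x"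
    by auto
qed

text \<open>One statement covers scaling (\<open>y = 0\<close>), translation (\<open>c = 1\<close>)
  and the weighted translates of a Gaussian.\<close>

lemma Ck_fun_cmult_shift:
  assumes "Ck_fun k f"
  shows "Ck_fun k (\<lambda>x. c * f (x - y))"
    and "i \<le> k \<Longrightarrow> nth_derivative i (\<lambda>x. c * f (x - y)) x = c * nth_derivative i f (x - y)"
proof -
  have "Ck_fun k (\<lambda>x. c * f (x - y)) \<and> (\<forall>i\<le>k. nth_derivative i (\<lambda>x. c * f (x - y)) =
      (\<lambda>x. c * nth_derivative i f (x - y)))"
    using assms
  proof (induction k arbitrary: f)
    case 0
    then have "continuous_on UNIV f" by (simp add: Ck_fun_0)
    moreover have "continuous_on UNIV (\<lambda>x. x - y)" by (intro continuous_intros)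
    ultimately have "continuous_on UNIV (\<lambda>x. f (x - y))"
      using continuous_on_compose[of UNIV "\<lambda>x. x - y" f] continuous_on_subset[of UNIV f]
      unfolding o_def by blast
    then have "continuous_on UNIV (\<lambda>x. c * f (x - y))" by (rule continuous_on_mult_left)
    then show ?case by (simp add: Ck_fun_0)
  next
    case (Suc k)
    obtain f' where f': "\<And>x. (f has_vector_derivative f' x) (at x)" "Ck_fun k f'"
      "\<And>i. nth_derivative (Suc i) f = nth_derivative i f'"
      using Ck_fun_SucE[OF Suc.prems] by blast
    have d: "((\<lambda>x. c * f (x - y)) has_vector_derivative c * f' (x - y)) (at x)" for x
    proof (rule has_vector_derivative_mult_right)
      have "((\<lambda>x. x - y) has_vector_derivative 1) (at x)"
        by (auto intro!: derivative_eq_intros)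
      from vector_diff_chain_at[OF this f'(1)[of "x - y"]]
      show "((\<lambda>x. f (x - y)) has_vector_derivative f' (x - y)) (at x)"
        by (simp add: o_def)
    qed
    note IH = Suc.IH[OF f'(2)]
    have "nth_derivative i (\<lambda>x. c * f (x - y)) = (\<lambda>x. c * nth_derivative i f (x - y))"
      if "i \<le> Suc k" for i
      using that IH f'(3) Ck_fun_SucI(2)[OF d] by (cases i) auto
    then show ?case using Ck_fun_SucI(1)[OF d] IH by blast
  qed
  then show "Ck_fun k (\<lambda>x. c * f (x - y))"
    "i \<le> k \<Longrightarrow> nth_derivative i (\<lambda>x. c * f (x - y)) x = c * nth_derivative i f (x - y)"
    by auto
qed

lemmas Ck_fun_cmult = Ck_fun_cmult_shift[where y=0, simplified]

lemma Ck_fun_mult: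
  assumes "Ck_fun k f" "Ck_fun k g"
  shows "Ck_fun k (\<lambda>x. f x * g x)"
  using assms
proof (induction k arbitrary: f g)
  case (Suc k)
  obtain f' where f': "\<And>x. (f has_vector_derivative f' x) (at x)" "Ck_fun k f'"
    by (rule Ck_fun_SucE[OF Suc.prems(1)]) (rule that, assumption+)
  obtain g' where g': "\<And>x. (g has_vector_derivative g' x) (at x)" "Ck_fun k g'"
    by (rule Ck_fun_SucE[OF Suc.prems(2)]) (rule that, assumption+)
  have "Ck_fun k f" "Ck_fun k g" using Suc.prems Ck_fun_mono[of "Suc k" _ k] by auto
  then have "Ck_fun k (\<lambda>x. f x * g' x + f' x * g x)"
    using Suc.IH f' g' Ck_fun_add(1) by blast
  then show ?case
    by (rule Ck_fun_SucI(1)[rotated]) (use f' g' in \<open>intro has_vector_derivative_mult\<close>)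
qed (auto simp: Ck_fun_0 intro: continuous_on_mult)

lemma Ck_fun_power: "Ck_fun k f \<Longrightarrow> Ck_fun k (\<lambda>x. f x ^ n)"
  by (induction n) (auto intro: Ck_fun_mult Ck_fun_const)

text \<open>Bounds replace the Leibniz formula: each derivative doubles the number of terms.\<close>

lemma cmod_nth_derivative_mult_le:
  assumes "Ck_fun k f" "Ck_fun k g" "i \<le> k"
    and "\<And>j. j \<le> i \<Longrightarrow> cmod (nth_derivative j f x) \<le> a"
    and "\<And>j. j \<le> i \<Longrightarrow> cmod (nth_derivative j g x) \<le> b"
  shows "cmod (nth_derivative i (\<lambda>x. f x * g x) x) \<le> 2 ^ i * (a * b)"
  using assms
proof (induction i arbitrary: k f g)
  case 0
  have "0 \<le> a" using order_trans[OF norm_ge_zero 0(4)[of 0]] by simp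
  then show ?case using 0 by (auto simp: norm_mult intro!: mult_mono)
next
  case (Suc i)
  from Suc.prems(3) obtain l where l: "k = Suc l" "i \<le> l" by (cases k) auto
  obtain f' where f': "\<And>x. (f has_vector_derivative f' x) (at x)" "Ck_fun l f'"
    "\<And>i. nth_derivative (Suc i) f = nth_derivative i f'"
    using Suc.prems(1) unfolding l by (rule Ck_fun_SucE) blast
  obtain g' where g': "\<And>x. (g has_vector_derivative g' x) (at x)" "Ck_fun l g'"
    "\<And>i. nth_derivative (Suc i) g = nth_derivative i g'"
    using Suc.prems(2) unfolding l by (rule Ck_fun_SucE) blast
  have fg: "Ck_fun l f" "Ck_fun l g" using Suc.prems l Ck_fun_mono[of "Suc l" _ l] by auto
  have d: "((\<lambda>x. f x * g x) has_vector_derivative f x * g' x + f' x * g x) (at x)" for x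
    using f' g' by (intro has_vector_derivative_mult)
  have "nth_derivative (Suc i) (\<lambda>x. f x * g x) x =
      nth_derivative i (\<lambda>x. f x * g' x) x + nth_derivative i (\<lambda>x. f' x * g x) x"
    unfolding Ck_fun_SucI(2)[OF d Ck_fun_add(1)[OF Ck_fun_mult[OF fg(1) g'(2)] Ck_fun_mult[OF f'(2) fg(2)]]]
    by (rule Ck_fun_add(2)[OF _ _ l(2)]) (use fg f' g' Ck_fun_mult in auto)
  moreover have "cmod (nth_derivative i (\<lambda>x. f x * g' x) x) \<le> 2 ^ i * (a * b)"
    by (rule Suc.IH[OF fg(1) g'(2) l(2)])
      (use Suc.prems(4,5) g'(3) in \<open>auto simp flip: g'(3)\<close>)
  moreover have "cmod (nth_derivative i (\<lambda>x. f' x * g x) x) \<le> 2 ^ i * (a * b)"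
    by (rule Suc.IH[OF f'(2) fg(2) l(2)])
      (use Suc.prems(4,5) f'(3) in \<open>auto simp flip: f'(3)\<close>)
  ultimately show ?case
    using norm_triangle_ineq[of "nth_derivative i (\<lambda>x. f x * g' x) x" "nth_derivative i (\<lambda>x. f' x * g x) x"]
    by simp
qed

text \<open>The weights enter as numbers at the fixed point \<open>x\<close>: dividing the two
  bounds by them reduces the claim to the unweighted product bound. The factor \<open>2 ^ i\<close>
  is finally enlarged to one independent of \<open>i\<close>.\<close>

lemma weighted_mult_le:
  assumes f: "Ck_fun k f" and g: "Ck_fun k g" and i: "i \<le> k"
    and w: "0 < w1 x" "0 < w2 x" "w x \<le> w1 x * w2 x"
    and a: "\<And>j. j \<le> k \<Longrightarrow> w1 x * cmod (nth_derivative j f x) \<le> a"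
    and b: "\<And>j. j \<le> k \<Longrightarrow> w2 x * cmod (nth_derivative j g x) \<le> b"
  shows "w x * cmod (nth_derivative i (\<lambda>x. f x * g x) x) \<le> 2 ^ k * (a * b)"
proof -
  have ab: "0 \<le> a" "0 \<le> b"
    using a[of 0] b[of 0] w by (smt (verit) le0 mult_nonneg_nonneg norm_ge_zero)+
  have "cmod (nth_derivative i (\<lambda>x. f x * g x) x) \<le> 2 ^ i * ((a / w1 x) * (b / w2 x))"
    using a b w i by (intro cmod_nth_derivative_mult_le[OF f g i]) (auto simp: field_simps)
  then have "w x * cmod (nth_derivative i (\<lambda>x. f x * g x) x)
      \<le> (w1 x * w2 x) * (2 ^ i * ((a / w1 x) * (b / w2 x)))"
    using w by (intro mult_mono) auto
  also have "\<dots> = 2 ^ i * (a * b)" using w by (simp add: field_simps)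
  also have "\<dots> \<le> 2 ^ k * (a * b)"
    using i ab by (intro mult_right_mono power_increasing) auto
  finally show ?thesis .
qed

section \<open>Weighted suprema and the spaces on which they are finite\<close>

lemma weighted_finite_iff:
  "weighted_finite w k f \<longleftrightarrow> (\<exists>C. \<forall>x. \<forall>i\<le>k. w x * cmod (nth_derivative i f x) \<le> C)"
  by (fastforce simp: weighted_finite_def weighted_values_def bdd_above_def)

lemma weighted_sup_upper:
  assumes "weighted_finite w k f" "i \<le> k"
  shows "w x * cmod (nth_derivative i f x) \<le> weighted_sup w k f"
  unfolding weighted_sup_def
  by (rule cSup_upper) (use assms in \<open>auto simp: weighted_finite_def weighted_values_def\<close>)

lemma weighted_sup_least:
  assumes "\<And>x i. i \<le> k \<Longrightarrow> w x * cmod (nth_derivative i f x) \<le> C"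
  shows "weighted_sup w k f \<le> C"
  unfolding weighted_sup_def
  by (rule cSup_least) (use assms in \<open>auto simp: weighted_values_def\<close>)

text \<open>Powers of \<open>1 + x^2\<close> as weights give the spaces behind
  \<open>schwartz_space\<close>, their reciprocals the steps \<open>OM_step\<close>, and rapidly
  decreasing weights the domains of the norms \<open>p_{m,v}\<close>.\<close>

definition weighted_space :: "(real \<Rightarrow> real) \<Rightarrow> nat \<Rightarrow> (real \<Rightarrow> complex) set" where
  "weighted_space w k = {f. Ck_fun k f \<and> weighted_finite w k f}"

lemma weighted_space_add:
  assumes w: "\<And>x. 0 \<le> w x" and f: "f \<in> weighted_space w k" and g: "g \<in> weighted_space w k"
  shows "f + g \<in> weighted_space w k"
    and "weighted_sup w k (f + g) \<le> weighted_sup w k f + weighted_sup w k g"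
proof -
  have ck: "Ck_fun k f" "Ck_fun k g" and fin: "weighted_finite w k f" "weighted_finite w k g"
    using f g by (auto simp: weighted_space_def)
  have le: "w x * cmod (nth_derivative i (f + g) x) \<le> weighted_sup w k f + weighted_sup w k g"
    if "i \<le> k" for x i
  proof -
    have "w x * cmod (nth_derivative i (f + g) x)
        \<le> w x * (cmod (nth_derivative i f x) + cmod (nth_derivative i g x))"
      unfolding func_plus Ck_fun_add(2)[OF ck that] using w by (intro mult_left_mono norm_triangle_ineq)
    also have "\<dots> \<le> weighted_sup w k f + weighted_sup w k g"
      unfolding distrib_left using fin that by (intro add_mono weighted_sup_upper)
    finally show ?thesis .
  qed
  show "f + g \<in> weighted_space w k"
    using Ck_fun_add(1)[OF ck] le by (auto simp: weighted_space_def weighted_finite_iff func_plus)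
  show "weighted_sup w k (f + g) \<le> weighted_sup w k f + weighted_sup w k g"
    using le by (rule weighted_sup_least)
qed

lemma weighted_space_cscale:
  assumes f: "f \<in> weighted_space w k"
  shows "cscale c f \<in> weighted_space w k"
    and "weighted_sup w k (cscale c f) \<le> cmod c * weighted_sup w k f"
proof -
  have ck: "Ck_fun k f" and fin: "weighted_finite w k f"
    using f by (auto simp: weighted_space_def)
  have le: "w x * cmod (nth_derivative i (cscale c f) x) \<le> cmod c * weighted_sup w k f"
    if "i \<le> k" for x i
  proof -
    have "w x * cmod (nth_derivative i (cscale c f) x) = cmod c * (w x * cmod (nth_derivative i f x))"
      unfolding cscale_def Ck_fun_cmult(2)[OF ck that] by (simp add: norm_mult)
    also have "\<dots> \<le> cmod c * weighted_sup w k f"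
      using weighted_sup_upper[OF fin that] by (intro mult_left_mono) auto
    finally show ?thesis .
  qed
  show "cscale c f \<in> weighted_space w k"
    using Ck_fun_cmult(1)[OF ck] le by (auto simp: weighted_space_def weighted_finite_iff cscale_def)
  show "weighted_sup w k (cscale c f) \<le> cmod c * weighted_sup w k f"
    using le by (rule weighted_sup_least)
qed

lemma weighted_sup_nonneg:
  assumes "\<And>x. 0 \<le> w x" "weighted_finite w k f"
  shows "0 \<le> weighted_sup w k f"
proof -
  have "0 \<le> w 0 * cmod (nth_derivative 0 f 0)" using assms by simp
  also have "\<dots> \<le> weighted_sup w k f" using assms by (intro weighted_sup_upper) auto
  finally show ?thesis .
qed

lemma csubspace_weighted_space:
  assumes "\<And>x. 0 \<le> w x"
  shows "csubspace (weighted_space w k)"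
proof -
  \<comment> \<open>The derivatives of zero are read off the scaling rule with factor 0.\<close>
  have "(\<lambda>x. 0) \<in> weighted_space w k"
    using Ck_fun_cmult(2)[OF Ck_fun_const[of k 0], of _ 0]
    by (auto simp: weighted_space_def weighted_finite_iff Ck_fun_const)
  then show ?thesis
    using weighted_space_add(1)[OF assms] weighted_space_cscale(1) by (auto simp: csubspace_def func_zero)
qed

lemma seminorm_on_weighted_sup:
  assumes "\<And>x. 0 \<le> w x"
  shows "seminorm_on (weighted_space w k) (weighted_sup w k)"
  using csubspace_weighted_space[OF assms]
proof (rule seminorm_onI)
  show "0 \<le> weighted_sup w k f" if "f \<in> weighted_space w k" for f
    using weighted_sup_nonneg[OF assms] that by (simp add: weighted_space_def)
qed (rule weighted_space_add(2)[OF assms] weighted_space_cscale(2); assumption)+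

lemma seminorm_on_subset: "seminorm_on E p \<Longrightarrow> F \<subseteq> E \<Longrightarrow> seminorm_on F p"
  unfolding seminorm_on_def by blast

subsection \<open>Gaussians\<close>

text \<open>Polynomials times \<open>exp (c * t^2)\<close> form a class closed under
  differentiation. With polynomial 1, the choice \<open>c = -1\<close> is the Gaussian and
  \<open>c = 1\<close> its reciprocal.\<close>

definition poly_gauss :: "real \<Rightarrow> real poly \<Rightarrow> real \<Rightarrow> complex" where
  "poly_gauss c p = (\<lambda>t. complex_of_real (poly p t * exp (c * t\<^sup>2)))"

lemma poly_gauss_derivative:
  "(poly_gauss c p has_vector_derivative poly_gauss c (pderiv p + [:0, 2 * c:] * p) t) (at t)"
  unfolding poly_gauss_def
  by (rule has_vector_derivative_of_real)
    (auto intro!: derivative_eq_intros simp: algebra_simps has_real_derivative_iff_has_vector_derivative[symmetric])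

lemma Ck_fun_poly_gauss: "Ck_fun k (poly_gauss c p)"
proof (induction k arbitrary: p)
  case 0
  show ?case unfolding Ck_fun_0 poly_gauss_def by (intro continuous_intros)
next
  case (Suc k)
  show ?case by (rule Ck_fun_SucI(1)[OF poly_gauss_derivative Suc])
qed

lemma nth_derivative_poly_gauss: "\<exists>q. nth_derivative i (poly_gauss c p) = poly_gauss c q"
proof (induction i arbitrary: p)
  case (Suc i)
  then show ?case
    using Ck_fun_SucI(2)[OF poly_gauss_derivative Ck_fun_poly_gauss] by metis
qed auto

text \<open>Induction along Horner's scheme: each step multiplies by \<open>t\<close>, and
  \<open>|t| \<le> 1 + t^2\<close> raises the exponent by one.\<close>

lemma poly_le_power: "\<exists>C n. \<forall>t::real. \<bar>poly p t\<bar> \<le> C * (1 + t\<^sup>2) ^ n"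
proof (induction p)
  case (pCons a p)
  then obtain C n where C: "\<And>t. \<bar>poly p t\<bar> \<le> C * (1 + t\<^sup>2) ^ n" by blast
  have "\<bar>poly (pCons a p) t\<bar> \<le> (\<bar>a\<bar> + C) * (1 + t\<^sup>2) ^ Suc n" for t
  proof -
    have t: "\<bar>t\<bar> \<le> 1 + t\<^sup>2"
      using zero_le_power2[of "\<bar>t\<bar> - 1"] by (simp add: power2_eq_square algebra_simps)
    have "\<bar>poly (pCons a p) t\<bar> \<le> \<bar>a\<bar> + \<bar>t\<bar> * \<bar>poly p t\<bar>"
      by (simp flip: abs_mult)
    also have "\<dots> \<le> \<bar>a\<bar> * (1 + t\<^sup>2) ^ Suc n + (1 + t\<^sup>2) * (C * (1 + t\<^sup>2) ^ n)"
    proof (rule add_mono)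
      show "\<bar>a\<bar> \<le> \<bar>a\<bar> * (1 + t\<^sup>2) ^ Suc n"
        using mult_left_mono[OF one_le_power[of "1 + t\<^sup>2" "Suc n"], of "\<bar>a\<bar>"] by simp
      show "\<bar>t\<bar> * \<bar>poly p t\<bar> \<le> (1 + t\<^sup>2) * (C * (1 + t\<^sup>2) ^ n)"
        using t C by (intro mult_mono) auto
    qed
    finally show ?thesis by (simp add: algebra_simps)
  qed
  then show ?case by blast
qed (auto intro: exI[of _ 0])

text \<open>Raise \<open>1 + t^2 \<le> m * (1 + t^2 / m) \<le> m * exp (t^2 / m)\<close> to the
  power \<open>m\<close>. Taking \<open>m = Suc n\<close> avoids a division by zero at
  \<open>n = 0\<close>.\<close>

lemma power_times_gauss_le: "(1 + t\<^sup>2) ^ n * exp (- (t\<^sup>2)) \<le> real (Suc n) ^ Suc n" for t :: real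
proof -
  define m where "m = Suc n"
  have t: "1 + t\<^sup>2 \<ge> 1" by simp
  have "1 + t\<^sup>2 \<le> real m * (1 + t\<^sup>2 / real m)" by (simp add: m_def field_simps)
  also have "\<dots> \<le> real m * exp (t\<^sup>2 / real m)"
    by (intro mult_left_mono exp_ge_add_one_self) auto
  finally have "(1 + t\<^sup>2) ^ m \<le> (real m * exp (t\<^sup>2 / real m)) ^ m"
    using t by (intro power_mono) auto
  also have "\<dots> = real m ^ m * exp (t\<^sup>2)"
  proof -
    have "exp (t\<^sup>2 / real m) ^ m = exp (t\<^sup>2)"
      unfolding exp_of_nat_mult[symmetric] by (simp add: m_def)
    then show ?thesis by (simp add: power_mult_distrib)
  qed
  finally have "(1 + t\<^sup>2) ^ m * exp (- (t\<^sup>2)) \<le> real m ^ m"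
    by (simp add: exp_minus field_simps)
  moreover have "(1 + t\<^sup>2) ^ n * exp (- (t\<^sup>2)) \<le> (1 + t\<^sup>2) ^ m * exp (- (t\<^sup>2))"
    using t by (intro mult_right_mono power_increasing) (auto simp: m_def)
  ultimately show ?thesis by (simp add: m_def)
qed

text \<open>Every derivative is a polynomial times the Gaussian, and the polynomial merely raises
  the exponent from \<open>n\<close> to \<open>n + l\<close>.\<close>

lemma gauss_rapidly_decreasing:
  "\<exists>C. \<forall>t. (1 + t\<^sup>2) ^ n * cmod (nth_derivative i (poly_gauss (-1) 1) t) \<le> C"
proof -
  obtain q where q: "nth_derivative i (poly_gauss (-1) 1) = poly_gauss (-1) q"
    using nth_derivative_poly_gauss by blast
  obtain C l where C: "\<And>t. \<bar>poly q t\<bar> \<le> C * (1 + t\<^sup>2) ^ l" using poly_le_power by metis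
  have C0: "0 \<le> C" using C[of 0] by simp
  have "(1 + t\<^sup>2) ^ n * cmod (poly_gauss (-1) q t) \<le> C * real (Suc (n + l)) ^ Suc (n + l)" for t
  proof -
    have "(1 + t\<^sup>2) ^ n * cmod (poly_gauss (-1) q t) = \<bar>poly q t\<bar> * ((1 + t\<^sup>2) ^ n * exp (- (t\<^sup>2)))"
      by (simp add: poly_gauss_def norm_mult)
    also have "\<dots> \<le> (C * (1 + t\<^sup>2) ^ l) * ((1 + t\<^sup>2) ^ n * exp (- (t\<^sup>2)))"
      using C by (intro mult_right_mono) auto
    also have "\<dots> = C * ((1 + t\<^sup>2) ^ (n + l) * exp (- (t\<^sup>2)))"
      by (simp add: power_add)
    also have "\<dots> \<le> C * real (Suc (n + l)) ^ Suc (n + l)"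
      using C0 power_times_gauss_le by (intro mult_left_mono)
    finally show ?thesis .
  qed
  then show ?thesis unfolding q by blast
qed


lemma csubspace_INT: "(\<And>i. i \<in> I \<Longrightarrow> csubspace (F i)) \<Longrightarrow> csubspace (\<Inter>i\<in>I. F i)"
  by (auto simp: csubspace_def)

subsection \<open>The spaces as seminormed spaces\<close>

lemma weighted_space_mono:
  assumes w: "\<And>x. 0 \<le> w x" "\<And>x. w x \<le> w' x" and k: "k \<le> k'"
    and f: "f \<in> weighted_space w' k'"
  shows "f \<in> weighted_space w k" and "weighted_sup w k f \<le> weighted_sup w' k' f"
proof -
  have le: "w x * cmod (nth_derivative i f x) \<le> weighted_sup w' k' f" if "i \<le> k" for x i
  proof -
    have "w x * cmod (nth_derivative i f x) \<le> w' x * cmod (nth_derivative i f x)"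
      using w by (intro mult_right_mono) auto
    also have "\<dots> \<le> weighted_sup w' k' f"
      using f that k by (intro weighted_sup_upper) (auto simp: weighted_space_def)
    finally show ?thesis .
  qed
  show "f \<in> weighted_space w k"
    using f k le Ck_fun_mono by (auto simp: weighted_space_def weighted_finite_iff)
  show "weighted_sup w k f \<le> weighted_sup w' k' f"
    using le by (rule weighted_sup_least)
qed

lemma weighted_space_mult:
  assumes w1: "\<And>x. 0 < w1 x" and w2: "\<And>x. 0 < w2 x" and w: "\<And>x. w x \<le> w1 x * w2 x"
    and f: "f \<in> weighted_space w1 k" and g: "g \<in> weighted_space w2 k"
  shows "(\<lambda>x. f x * g x) \<in> weighted_space w k"
    and "weighted_sup w k (\<lambda>x. f x * g x) \<le> 2 ^ k * (weighted_sup w1 k f * weighted_sup w2 k g)"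
proof -
  have ck: "Ck_fun k f" "Ck_fun k g" and fin: "weighted_finite w1 k f" "weighted_finite w2 k g"
    using f g by (auto simp: weighted_space_def)
  have le: "w x * cmod (nth_derivative i (\<lambda>x. f x * g x) x)
      \<le> 2 ^ k * (weighted_sup w1 k f * weighted_sup w2 k g)" if "i \<le> k" for x i
    by (rule weighted_mult_le[where x=x and w=w and ?w1.0=w1 and ?w2.0=w2 and f=f and g=g, OF ck that w1[of x] w2[of x] w[of x]]) (use fin in \<open>auto intro: weighted_sup_upper\<close>)
  show "(\<lambda>x. f x * g x) \<in> weighted_space w k"
    using Ck_fun_mult[OF ck] le by (auto simp: weighted_space_def weighted_finite_iff)
  show "weighted_sup w k (\<lambda>x. f x * g x) \<le> 2 ^ k * (weighted_sup w1 k f * weighted_sup w2 k g)"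
    using le by (rule weighted_sup_least)
qed

lemma one_plus_square_ge_1: "1 \<le> 1 + x\<^sup>2" and one_plus_square_pos: "0 < 1 + x\<^sup>2" for x :: real
  by (simp_all add: add_pos_nonneg)

lemma schwartz_space_eq: "schwartz_space = (\<Inter>n. weighted_space (\<lambda>x. (1 + x\<^sup>2) ^ n) n)"
  by (auto simp: schwartz_space_def weighted_space_def smooth_fun_def)

lemma OM_step_eq: "OM_step m n = weighted_space (\<lambda>x. 1 / (1 + x\<^sup>2) ^ n) m"
  by (simp add: OM_step_def weighted_space_def)

abbreviation "OM_norm m n \<equiv> weighted_sup (\<lambda>x. 1 / (1 + x\<^sup>2) ^ n) m"

lemma OM_step_mono: "n \<le> n' \<Longrightarrow> OM_step m n \<subseteq> OM_step m n'"
  unfolding OM_step_eq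
  by (intro subsetI weighted_space_mono(1)[of "\<lambda>x. 1 / (1 + x\<^sup>2) ^ n'" "\<lambda>x. 1 / (1 + x\<^sup>2) ^ n"])
    (auto intro!: divide_left_mono power_increasing simp: one_plus_square_pos)

lemma OM_norm_nonneg: "f \<in> OM_step m n \<Longrightarrow> 0 \<le> OM_norm m n f"
  by (rule weighted_sup_nonneg) (auto simp: OM_step_def)

lemma OM_step_mult:
  assumes "f \<in> OM_step m n" "g \<in> OM_step m l"
  shows "(\<lambda>x. f x * g x) \<in> OM_step m (n + l)"
    and "OM_norm m (n + l) (\<lambda>x. f x * g x) \<le> 2 ^ m * (OM_norm m n f * OM_norm m l g)"
proof -
  have w: "1 / (1 + x\<^sup>2) ^ (n + l) \<le> 1 / (1 + x\<^sup>2) ^ n * (1 / (1 + x\<^sup>2) ^ l)" for x :: real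
    by (simp add: power_add)
  note prod = weighted_space_mult[OF _ _ w assms[unfolded OM_step_eq]]
  show "(\<lambda>x. f x * g x) \<in> OM_step m (n + l)"
    unfolding OM_step_eq by (rule prod(1)) (simp_all add: one_plus_square_pos)
  show "OM_norm m (n + l) (\<lambda>x. f x * g x) \<le> 2 ^ m * (OM_norm m n f * OM_norm m l g)"
    by (rule prod(2)) (simp_all add: one_plus_square_pos)
qed

text \<open>The weight \<open>(1 + x^2)^m\<close> splits into \<open>(1 + x^2)^(-n)\<close> for
  \<open>f\<close> and \<open>(1 + x^2)^(m + n)\<close> for \<open>g\<close>. Schwartz norms tie the
  exponent to the order, so \<open>g\<close> is first taken down from order \<open>m + n\<close> to
  order \<open>m\<close>.\<close>

lemma schwartz_mult:
  assumes "f \<in> OM_step m n" "g \<in> schwartz_space"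
  shows "(\<lambda>x. f x * g x) \<in> weighted_space (\<lambda>x. (1 + x\<^sup>2) ^ m) m"
    and "weighted_sup (\<lambda>x. (1 + x\<^sup>2) ^ m) m (\<lambda>x. f x * g x)
      \<le> 2 ^ m * (OM_norm m n f * weighted_sup (\<lambda>x. (1 + x\<^sup>2) ^ (m + n)) (m + n) g)"
proof -
  have g: "g \<in> weighted_space (\<lambda>x. (1 + x\<^sup>2) ^ (m + n)) (m + n)"
    using assms by (auto simp: schwartz_space_eq)
  have g': "g \<in> weighted_space (\<lambda>x. (1 + x\<^sup>2) ^ (m + n)) m"
    "weighted_sup (\<lambda>x. (1 + x\<^sup>2) ^ (m + n)) m g \<le> weighted_sup (\<lambda>x. (1 + x\<^sup>2) ^ (m + n)) (m + n) g"
    by (rule weighted_space_mono[OF _ _ _ g]; simp)+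
  have w: "(1 + x\<^sup>2) ^ m \<le> 1 / (1 + x\<^sup>2) ^ n * (1 + x\<^sup>2) ^ (m + n)" for x :: real
    using one_plus_square_pos[of x] by (simp add: power_add field_simps)
  note prod = weighted_space_mult[OF _ _ w assms(1)[unfolded OM_step_eq] g'(1)]
  show "(\<lambda>x. f x * g x) \<in> weighted_space (\<lambda>x. (1 + x\<^sup>2) ^ m) m"
    by (rule prod(1)) (simp_all add: one_plus_square_pos)
  have "weighted_sup (\<lambda>x. (1 + x\<^sup>2) ^ m) m (\<lambda>x. f x * g x)
      \<le> 2 ^ m * (OM_norm m n f * weighted_sup (\<lambda>x. (1 + x\<^sup>2) ^ (m + n)) m g)"
    by (rule prod(2)) (simp_all add: one_plus_square_pos)
  also have "\<dots> \<le> 2 ^ m * (OM_norm m n f * weighted_sup (\<lambda>x. (1 + x\<^sup>2) ^ (m + n)) (m + n) g)"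
    using g'(2) OM_norm_nonneg[OF assms(1)] by (intro mult_left_mono) auto
  finally show "weighted_sup (\<lambda>x. (1 + x\<^sup>2) ^ m) m (\<lambda>x. f x * g x)
      \<le> 2 ^ m * (OM_norm m n f * weighted_sup (\<lambda>x. (1 + x\<^sup>2) ^ (m + n)) (m + n) g)" .
qed

lemma seminormed_schwartz:
  "seminormed schwartz_space {weighted_sup (\<lambda>x. (1 + x\<^sup>2) ^ n) n |n. True}"
proof
  show "csubspace schwartz_space"
    unfolding schwartz_space_eq by (intro csubspace_INT csubspace_weighted_space) simp
next
  fix p assume "p \<in> {weighted_sup (\<lambda>x. (1 + x\<^sup>2) ^ n) n |n. True}"
  then obtain n where p: "p = weighted_sup (\<lambda>x. (1 + x\<^sup>2) ^ n) n" by blast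
  have "seminorm_on (weighted_space (\<lambda>x. (1 + x\<^sup>2) ^ n) n) p"
    unfolding p by (rule seminorm_on_weighted_sup) simp
  then show "seminorm_on schwartz_space p"
    by (rule seminorm_on_subset) (auto simp: schwartz_space_eq)
qed blast

section \<open>The inductive limits of the steps and their projective limit\<close>

definition OM_seminorms :: "nat \<Rightarrow> ((real \<Rightarrow> complex) \<Rightarrow> real) set" where
  "OM_seminorms m = {q. seminorm_on (\<Union>n\<in>{1..}. OM_step m n) q \<and>
     (\<forall>n\<ge>1. \<exists>C. \<forall>f\<in>OM_step m n. q f \<le> C * OM_norm m n f)}"

lemma OM_seminorms_le:
  "p \<in> OM_seminorms m \<Longrightarrow> 1 \<le> n \<Longrightarrow> \<exists>C. \<forall>f\<in>OM_step m n. p f \<le> C * OM_norm m n f"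
  by (simp add: OM_seminorms_def)

text \<open>The steps increase with \<open>n\<close>, so any two functions lie in a common step,
  that of index \<open>max n l\<close>.\<close>

lemma csubspace_OM_steps: "csubspace (\<Union>n\<in>{1..}. OM_step m n)"
proof -
  have step: "csubspace (OM_step m n)" for n
    unfolding OM_step_eq by (rule csubspace_weighted_space) simp
  show ?thesis
    unfolding csubspace_def
  proof (intro conjI ballI allI)
    show "0 \<in> (\<Union>n\<in>{1..}. OM_step m n)"
      by (rule UN_I[of 1]) (use step[of 1] in \<open>simp_all add: csubspace_def\<close>)
  next
    fix f g c assume "f \<in> (\<Union>n\<in>{1..}. OM_step m n)"
    then obtain n where n: "1 \<le> n" and f: "f \<in> OM_step m n" by auto
    show "cscale c f \<in> (\<Union>n\<in>{1..}. OM_step m n)"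
      by (rule UN_I[of n]) (use step[of n] n f in \<open>simp_all add: csubspace_def\<close>)
    assume "g \<in> (\<Union>n\<in>{1..}. OM_step m n)"
    then obtain l where "g \<in> OM_step m l" by auto
    with f have "f \<in> OM_step m (max n l)" "g \<in> OM_step m (max n l)"
      using OM_step_mono[of n "max n l"] OM_step_mono[of l "max n l"] by auto
    then show "f + g \<in> (\<Union>n\<in>{1..}. OM_step m n)"
      using step[of "max n l"] n by (intro UN_I[of "max n l"]) (simp_all add: csubspace_def)
  qed
qed

lemma zero_in_OM_seminorms: "(\<lambda>_. 0) \<in> OM_seminorms m"
  by (auto simp: OM_seminorms_def seminorm_on_def intro!: exI[of _ 0])

lemma seminormed_OM_step_limit: "seminormed (\<Union>n\<in>{1..}. OM_step m n) (OM_seminorms m)"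
proof
  show "OM_seminorms m \<noteq> {}" using zero_in_OM_seminorms by blast
qed (simp_all add: OM_seminorms_def csubspace_OM_steps del: One_nat_def)

lemma OM_step_limit_eq: "OM_step_limit m = seminorm_topology (\<Union>n\<in>{1..}. OM_step m n) (OM_seminorms m)"
  by (simp add: OM_step_limit_def lc_inductive_limit_def OM_seminorms_def)

lemma OM_space_eq: "OM_space = (\<Inter>m\<in>{1..}. \<Union>n\<in>{1..}. OM_step m n)"
proof -
  \<comment> \<open>Smoothness includes order 0, which the range \<open>m \<ge> 1\<close> omits;
    every order \<open>k\<close> is inherited from \<open>Suc k\<close>.\<close>
  have "Ck_fun k f" if "\<forall>m\<ge>1. Ck_fun m f" for k f
    using that Ck_fun_mono[of "Suc k" f k] by auto
  then have "smooth_fun f \<longleftrightarrow> (\<forall>m\<ge>1. Ck_fun m f)" for f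
    unfolding smooth_fun_def by blast
  then show ?thesis
    by (simp add: set_eq_iff OM_space_def OM_step_def Bex_def Ball_def) blast
qed

lemma OM_space_subset: "1 \<le> m \<Longrightarrow> OM_space \<subseteq> (\<Union>n\<in>{1..}. OM_step m n)"
  by (auto simp: OM_space_eq)

lemma csubspace_OM_space: "csubspace OM_space"
  unfolding OM_space_eq by (intro csubspace_INT csubspace_OM_steps)

lemma seminormed_OM: "seminormed OM_space (\<Union>m\<in>{1..}. OM_seminorms m)"
proof
  fix p assume "p \<in> (\<Union>m\<in>{1..}. OM_seminorms m)"
  then obtain m where "m \<ge> 1" "seminorm_on (\<Union>n\<in>{1..}. OM_step m n) p"
    by (auto simp: OM_seminorms_def)
  then show "seminorm_on OM_space p"
    using OM_space_subset seminorm_on_subset by blast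
qed (use csubspace_OM_space zero_in_OM_seminorms in auto)

text \<open>An open set of one step limit contains finite balls, whose traces on
  \<open>OM_space\<close> are balls of the same seminorms. Conversely a ball of one seminorm is the
  trace of an open ball of its step limit. Different \<open>m\<close> are combined by the generated
  topologies themselves.\<close>

lemma OM_topology_eq: "OM_topology = seminorm_topology OM_space (\<Union>m\<in>{1..}. OM_seminorms m)"
proof (rule topology_eq[THEN iffD2], intro allI iffI)
  interpret OM: seminormed OM_space "\<Union>m\<in>{1..}. OM_seminorms m" by (rule seminormed_OM)
  fix U
  {
    assume "openin OM_topology U"
    then have "generate_topology_on {OM_space \<inter> U |m U. 1 \<le> m \<and> openin (OM_step_limit m) U} U"
      by (simp add: OM_topology_def openin_topology_generated_by_iff)
    then show "openin OM.X U"
    proof induction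
      case (Basis s)
      then obtain m U where s: "s = OM_space \<inter> U" and m: "1 \<le> m" "openin (OM_step_limit m) U"
        by blast
      interpret step: seminormed "\<Union>n\<in>{1..}. OM_step m n" "OM_seminorms m"
        by (rule seminormed_OM_step_limit)
      show ?case
        unfolding OM.openin_X
      proof (intro conjI ballI)
        fix f assume f: "f \<in> s"
        then obtain F e where F: "finite F" "F \<subseteq> OM_seminorms m" "0 < e"
          "{g \<in> (\<Union>n\<in>{1..}. OM_step m n). \<forall>p\<in>F. p (g - f) < e} \<subseteq> U"
          using m(2) unfolding OM_step_limit_eq step.openin_X s by blast
        have "{g \<in> OM_space. \<forall>p\<in>F. p (g - f) < e} \<subseteq> s"
          using F(4) OM_space_subset[OF m(1)] unfolding s by blast
        with F m(1) show "\<exists>F e. finite F \<and> F \<subseteq> (\<Union>m\<in>{1..}. OM_seminorms m) \<and> 0 < e \<and>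
            {g \<in> OM_space. \<forall>p\<in>F. p (g - f) < e} \<subseteq> s"
          by (intro exI[of _ F] exI[of _ e]) auto
      qed (auto simp: s)
    qed auto
  next
    assume "openin OM.X U"
    then have "generate_topology_on {{g \<in> OM_space. p (g - f) < e} |p f e.
        p \<in> (\<Union>m\<in>{1..}. OM_seminorms m) \<and> f \<in> OM_space \<and> 0 < e} U"
      by (simp add: seminorm_topology_def openin_topology_generated_by_iff)
    then show "openin OM_topology U"
    proof induction
      case (Basis s)
      then obtain p f e m where s: "s = {g \<in> OM_space. p (g - f) < e}"
        and m: "1 \<le> m" "p \<in> OM_seminorms m" and f: "f \<in> OM_space" and e: "0 < e"
        by auto
      interpret step: seminormed "\<Union>n\<in>{1..}. OM_step m n" "OM_seminorms m"
        by (rule seminormed_OM_step_limit)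
      have "openin (OM_step_limit m) {g \<in> (\<Union>n\<in>{1..}. OM_step m n). p (g - f) < e}"
        unfolding OM_step_limit_eq
        by (rule step.openin_ball[OF m(2) _ e]) (use OM_space_subset[OF m(1)] f in blast)
      moreover have "s = OM_space \<inter> {g \<in> (\<Union>n\<in>{1..}. OM_step m n). p (g - f) < e}"
        using OM_space_subset[OF m(1)] unfolding s by blast
      ultimately show ?case
        unfolding OM_topology_def using m(1) by (intro topology_generated_by_Basis) blast
    qed auto
  }
qed

section \<open>Multiplication by functions in O_M\<close>

lemma schwartz_times_OM: "h \<in> OM_space \<Longrightarrow> f \<in> schwartz_space \<Longrightarrow> (\<lambda>x. h x * f x) \<in> schwartz_space"
proof -
  assume h: "h \<in> OM_space" and f: "f \<in> schwartz_space"
  have "(\<lambda>x. h x * f x) \<in> weighted_space (\<lambda>x. (1 + x\<^sup>2) ^ n) n" for n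
  proof -
    \<comment> \<open>The steps describing \<open>OM_space\<close> start at order 1, the Schwartz
      norms at order 0; hence \<open>Suc n\<close>, which is lowered again by monotonicity.\<close>
    obtain l where "h \<in> OM_step (Suc n) l" using h OM_space_subset[of "Suc n"] by auto
    from schwartz_mult(1)[OF this f] show ?thesis
      by (rule weighted_space_mono(1)[rotated 3]) (auto intro!: power_increasing simp del: power_Suc)
  qed
  then show ?thesis by (simp add: schwartz_space_eq)
qed

lemma OM_times_OM: "h \<in> OM_space \<Longrightarrow> f \<in> OM_space \<Longrightarrow> (\<lambda>x. h x * f x) \<in> OM_space"
  unfolding OM_space_eq using OM_step_mult(1) by fastforce

lemma Ck_fun_OM: "h \<in> OM_space \<Longrightarrow> Ck_fun k h"
  by (simp add: OM_space_def smooth_fun_def)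

text \<open>The constant 1 is the test function whose iterates under \<open>mult_operator h\<close>
  are the powers of \<open>h\<close>.\<close>

lemma one_in_OM_space: "(\<lambda>x. 1) \<in> OM_space"
proof -
  have "cmod (nth_derivative i (\<lambda>x. 1) x) \<le> 1" for i x
  proof (cases i)
    case (Suc j)
    have "nth_derivative j (\<lambda>x. 0) x = 0"
      using Ck_fun_cmult(2)[OF Ck_fun_const[of j 0], of j 0 x] by simp
    then show ?thesis
      using Suc Ck_fun_SucI(2)[of "\<lambda>x. 1" "\<lambda>x. 0" j j] Ck_fun_const[of j 0] by simp
  qed simp
  then have "1 / (1 + x\<^sup>2) ^ 1 * cmod (nth_derivative i (\<lambda>x. 1) x) \<le> 1" for i x
    using order_trans[OF _ one_plus_square_ge_1[of x]]
    by (simp add: divide_le_eq_1 one_plus_square_pos)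
  then have "(\<lambda>x. 1) \<in> OM_step m 1" for m
    unfolding OM_step_def weighted_finite_iff using Ck_fun_const by blast
  then show ?thesis unfolding OM_space_eq by fastforce
qed

lemma mult_operator_funpow: "(mult_operator h ^^ n) f = (\<lambda>x. h x ^ n * f x)"
  by (induction n) (auto simp: mult_operator_def mult.assoc)

lemma mult_operator_add: "mult_operator h (f + g) = mult_operator h f + mult_operator h g"
  and mult_operator_cscale: "mult_operator h (cscale c f) = cscale c (mult_operator h f)"
  by (auto simp: mult_operator_def cscale_def fun_eq_iff algebra_simps)

subsection \<open>Rapidly decreasing weights\<close>

text \<open>No regularity of the weight is required, so indicators of points and of sequences are admissible.\<close>

definition rapidly_decreasing :: "(real \<Rightarrow> real) \<Rightarrow> bool" where
  "rapidly_decreasing v \<longleftrightarrow> (\<forall>x. 0 \<le> v x) \<and> (\<forall>n. \<exists>C. \<forall>x. v x * (1 + x\<^sup>2) ^ n \<le> C)"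

lemma moderate_growth_if_weighted_bounded:
  assumes bounded: "\<And>v. rapidly_decreasing v \<Longrightarrow> \<exists>C. \<forall>x. v x * g x \<le> C"
  shows "\<exists>n\<ge>1. \<exists>C. \<forall>x. g x \<le> C * (1 + x\<^sup>2) ^ n"
proof (rule ccontr)
  assume "\<not> ?thesis"
  \<comment> \<open>Factor and exponent grow together, so a single sequence defeats all pairs of a
    constant and an exponent.\<close>
  then have "\<exists>x. real (Suc n) * (1 + x\<^sup>2) ^ Suc n < g x" for n
    by (metis Suc_le_eq zero_less_Suc not_le One_nat_def)
  then obtain X where X: "\<And>n. real (Suc n) * (1 + (X n)\<^sup>2) ^ Suc n < g (X n)" by metis
  have power_less: "(1 + (X n)\<^sup>2) ^ k < g (X n)" if "k \<le> Suc n" for n k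
  proof -
    have "(1 + (X n)\<^sup>2) ^ k \<le> 1 * (1 + (X n)\<^sup>2) ^ Suc n"
      using power_increasing[OF that one_plus_square_ge_1] by (simp del: power_Suc)
    also have "\<dots> \<le> real (Suc n) * (1 + (X n)\<^sup>2) ^ Suc n"
      by (intro mult_right_mono) auto
    finally show ?thesis using X[of n] by linarith
  qed
  have pos: "0 < g (X n)" for n using power_less[of 0 n] by simp
  \<comment> \<open>The square root meets two demands: \<open>v\<close> decays because
    \<open>g\<close> exceeds all powers along \<open>X\<close>, while \<open>v * g = sqrt g\<close>
    is still unbounded there. Defining \<open>v\<close> through the range of \<open>X\<close> allows
    repeated values of \<open>X\<close>.\<close>
  define v where "v x = (if x \<in> range X then 1 / sqrt (g x) else 0)" for x
  have v_nonneg: "0 \<le> v x" for x using pos by (auto simp: v_def less_imp_le)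
  have "\<exists>C. \<forall>x. v x * (1 + x\<^sup>2) ^ N \<le> C" for N
  proof (intro exI allI)
    fix x
    \<comment> \<open>For \<open>n \<ge> 2 * N\<close> the weighted value at \<open>X n\<close> is
      at most 1, since \<open>g\<close> exceeds the square of \<open>(1 + x^2)^N\<close> there; the
      sum pays for the finitely many smaller \<open>n\<close>.\<close>
    define C where "C = 1 + (\<Sum>n<2*N. v (X n) * (1 + (X n)\<^sup>2) ^ N)"
    have C1: "1 \<le> C" using v_nonneg by (auto simp: C_def intro!: sum_nonneg)
    have "v x * (1 + x\<^sup>2) ^ N \<le> C"
    proof (cases "x \<in> range X")
      case True
      then obtain n where n: "x = X n" by blast
      show ?thesis
      proof (cases "n < 2 * N")
        case True
        then have "v (X n) * (1 + (X n)\<^sup>2) ^ N \<le> (\<Sum>n<2*N. v (X n) * (1 + (X n)\<^sup>2) ^ N)"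
          by (intro member_le_sum) (auto intro!: mult_nonneg_nonneg v_nonneg)
        then show ?thesis by (simp add: C_def n)
      next
        case False
        have "((1 + x\<^sup>2) ^ N)\<^sup>2 \<le> g x"
          using power_less[of "N * 2" n] False by (simp add: n power_mult)
        then have "(1 + x\<^sup>2) ^ N \<le> sqrt (g x)" by (rule real_le_rsqrt)
        then have "v x * (1 + x\<^sup>2) ^ N \<le> 1" using pos[of n] by (simp add: v_def n)
        then show ?thesis using C1 by linarith
      qed
    next
      case False
      then show ?thesis using C1 by (simp add: v_def)
    qed
    then show "v x * (1 + x\<^sup>2) ^ N \<le> 1 + (\<Sum>n<2*N. v (X n) * (1 + (X n)\<^sup>2) ^ N)"
      by (simp add: C_def)
  qed
  then have "rapidly_decreasing v" using v_nonneg by (simp add: rapidly_decreasing_def)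
  then obtain C where C: "\<And>x. v x * g x \<le> C" using bounded by blast
  have "sqrt (g (X n)) \<le> C" for n
    using C[of "X n"] pos[of n] by (simp add: v_def real_div_sqrt)
  then have "g (X n) \<le> C\<^sup>2" for n
    using sqrt_le_D by blast
  moreover obtain n where "C\<^sup>2 < real n" using reals_Archimedean2 by blast
  \<comment> \<open>The factor \<open>real (Suc n)\<close> forces divergence even if
    \<open>X n\<close> is 0, where the power alone is only 1.\<close>
  moreover have "real n \<le> g (X n)"
  proof -
    have "real n \<le> real (Suc n) * 1" by simp
    also have "\<dots> \<le> real (Suc n) * (1 + (X n)\<^sup>2) ^ Suc n"
      by (intro mult_left_mono one_le_power one_plus_square_ge_1) simp
    finally show ?thesis using X[of n] by linarith
  qed
  ultimately show False by (meson linorder_not_le order_trans)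
qed

section \<open>The two estimates on the powers of \<open>h\<close>\<close>

definition powers_weighted_bounded :: "(real \<Rightarrow> complex) \<Rightarrow> bool" where
  "powers_weighted_bounded h \<longleftrightarrow> (\<forall>m v. rapidly_decreasing v \<longrightarrow>
     (\<exists>C. \<forall>k\<ge>1. \<forall>i\<le>m. \<forall>x. v x * cmod (nth_derivative i (\<lambda>x. h x ^ k) x) \<le> C))"

text \<open>This is estimate (b): exponent and constant are chosen before \<open>k\<close>, so one
  normed step contains all powers as a bounded set.\<close>

definition powers_step_bounded :: "(real \<Rightarrow> complex) \<Rightarrow> bool" where
  "powers_step_bounded h \<longleftrightarrow> (\<forall>m\<ge>1. \<exists>n\<ge>1. \<exists>C. \<forall>k\<ge>1.
     (\<lambda>x. h x ^ k) \<in> OM_step m n \<and> OM_norm m n (\<lambda>x. h x ^ k) \<le> C)"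

lemma powers_step_boundedE:
  assumes "powers_step_bounded h" "1 \<le> m"
  obtains n C where "1 \<le> n" "\<And>k. 1 \<le> k \<Longrightarrow> (\<lambda>x. h x ^ k) \<in> OM_step m n"
    "\<And>k. 1 \<le> k \<Longrightarrow> OM_norm m n (\<lambda>x. h x ^ k) \<le> C"
proof -
  have "\<exists>n\<ge>1. \<exists>C. \<forall>k\<ge>1. (\<lambda>x. h x ^ k) \<in> OM_step m n \<and> OM_norm m n (\<lambda>x. h x ^ k) \<le> C"
    using assms by (simp add: powers_step_bounded_def)
  then obtain n C where "1 \<le> n"
    "\<forall>k\<ge>1. (\<lambda>x. h x ^ k) \<in> OM_step m n \<and> OM_norm m n (\<lambda>x. h x ^ k) \<le> C"
    by (elim exE conjE)
  then show thesis by (intro that[of n C]) simp_all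
qed

lemma powers_step_bounded_if_weighted_bounded:
  assumes h: "h \<in> OM_space" and bounded: "powers_weighted_bounded h"
  shows "powers_step_bounded h"
  unfolding powers_step_bounded_def
proof (intro allI impI)
  fix m :: nat
  define A where "A x = {cmod (nth_derivative i (\<lambda>x. h x ^ k) x) |i k. i \<le> m \<and> k \<ge> 1}" for x
  have ne: "A x \<noteq> {}" for x by (auto simp: A_def)
  have bdd: "bdd_above (A y)" for y
  proof -
    \<comment> \<open>The indicator of a point is an admissible weight. It bounds
      \<open>A y\<close>, so that \<open>Sup (A y)\<close> is a genuine supremum.\<close>
    define v :: "real \<Rightarrow> real" where "v x = (if x = y then 1 else 0)" for x
    have "rapidly_decreasing v"
      unfolding rapidly_decreasing_def
    proof (intro conjI allI)
      fix n
      show "\<exists>C. \<forall>x. v x * (1 + x\<^sup>2) ^ n \<le> C"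
        by (rule exI[of _ "(1 + y\<^sup>2) ^ n"]) (auto simp: v_def)
    qed (simp add: v_def)
    then obtain C where "\<And>k i x. k \<ge> 1 \<Longrightarrow> i \<le> m \<Longrightarrow> v x * cmod (nth_derivative i (\<lambda>x. h x ^ k) x) \<le> C"
      using bounded unfolding powers_weighted_bounded_def by meson
    from this[of _ _ y] show ?thesis by (auto simp: A_def v_def intro!: bdd_aboveI[of _ C])
  qed
  have "\<exists>C. \<forall>x. v x * Sup (A x) \<le> C" if v: "rapidly_decreasing v" for v
  proof -
    obtain C where C: "\<And>k i x. k \<ge> 1 \<Longrightarrow> i \<le> m \<Longrightarrow> v x * cmod (nth_derivative i (\<lambda>x. h x ^ k) x) \<le> C"
      using bounded v unfolding powers_weighted_bounded_def by meson
    have v0: "0 \<le> v x" for x using v by (simp add: rapidly_decreasing_def)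
    \<comment> \<open>This covers the points with \<open>v x = 0\<close>, where the bound cannot be
      divided by the weight.\<close>
    have C0: "0 \<le> C"
      using order_trans[OF mult_nonneg_nonneg[OF v0 norm_ge_zero] C[of 1 0 0]] by simp
    have "v x * Sup (A x) \<le> C" for x
    proof (cases "v x = 0")
      case False
      then have vx: "0 < v x" using v0[of x] by simp
      have "Sup (A x) \<le> C / v x"
        by (rule cSup_least[OF ne]) (use C vx in \<open>auto simp: A_def field_simps\<close>)
      then show ?thesis using vx by (simp add: field_simps)
    qed (simp add: C0)
    then show ?thesis by blast
  qed
  then obtain n C where n: "n \<ge> 1" and C: "\<And>x. Sup (A x) \<le> C * (1 + x\<^sup>2) ^ n"
    using moderate_growth_if_weighted_bounded[of "\<lambda>x. Sup (A x)"] by blast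
  have "1 / (1 + x\<^sup>2) ^ n * cmod (nth_derivative i (\<lambda>x. h x ^ k) x) \<le> C"
    if "i \<le> m" "k \<ge> 1" for i k x
  proof -
    have "cmod (nth_derivative i (\<lambda>x. h x ^ k) x) \<le> Sup (A x)"
      using bdd that by (intro cSup_upper) (auto simp: A_def)
    also have "\<dots> \<le> C * (1 + x\<^sup>2) ^ n" by (rule C)
    finally show ?thesis by (simp add: divide_le_eq one_plus_square_pos)
  qed
  moreover have "Ck_fun m (\<lambda>x. h x ^ k)" for k
    using Ck_fun_power Ck_fun_OM[OF h] by blast
  ultimately show "\<exists>n\<ge>1. \<exists>C. \<forall>k\<ge>1.
      (\<lambda>x. h x ^ k) \<in> OM_step m n \<and> OM_norm m n (\<lambda>x. h x ^ k) \<le> C"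
    using n by (intro exI[of _ n] exI[of _ C] conjI allI impI weighted_sup_least)
      (auto simp: OM_step_def weighted_finite_iff)
qed

text \<open>On step \<open>n\<close> the factor \<open>v x * (1 + x^2)^n\<close> is bounded, so the
  norm with weight \<open>v\<close> is at most a multiple of each step norm and hence continuous on
  the inductive limit.\<close>

lemma weighted_sup_in_OM_seminorms:
  assumes v: "rapidly_decreasing v"
  shows "weighted_sup v m \<in> OM_seminorms m"
    and "OM_step m n \<subseteq> weighted_space v m"
proof -
  have v0: "0 \<le> v x" for x using v by (simp add: rapidly_decreasing_def)
  have bound: "\<exists>C. \<forall>f\<in>OM_step m n. \<forall>i\<le>m. \<forall>x. v x * cmod (nth_derivative i f x) \<le> C * OM_norm m n f" for n
  proof -
    obtain C where C: "\<And>x. v x * (1 + x\<^sup>2) ^ n \<le> C" using v unfolding rapidly_decreasing_def by metis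
    have "v x * cmod (nth_derivative i f x) \<le> C * OM_norm m n f"
      if f: "f \<in> OM_step m n" and i: "i \<le> m" for f i x
    proof -
      have "v x * cmod (nth_derivative i f x)
          = (v x * (1 + x\<^sup>2) ^ n) * (1 / (1 + x\<^sup>2) ^ n * cmod (nth_derivative i f x))"
        using one_plus_square_pos[of x] by simp
      also have "\<dots> \<le> C * OM_norm m n f"
        using f i C order_trans[OF mult_nonneg_nonneg[OF v0] C]
        by (intro mult_mono weighted_sup_upper[where i=i]) (auto simp: OM_step_def)
      finally show ?thesis .
    qed
    then show ?thesis by blast
  qed
  show sub: "OM_step m n \<subseteq> weighted_space v m" for n
    using bound[of n] by (auto simp: weighted_space_def weighted_finite_iff OM_step_def)
  have "seminorm_on (\<Union>n\<in>{1..}. OM_step m n) (weighted_sup v m)"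
    by (rule seminorm_on_subset[OF seminorm_on_weighted_sup[of v m, OF v0]]) (use sub in blast)
  moreover have "\<exists>C. \<forall>f\<in>OM_step m n. weighted_sup v m f \<le> C * OM_norm m n f" for n
    using bound[of n] weighted_sup_least by meson
  ultimately show "weighted_sup v m \<in> OM_seminorms m"
    by (simp add: OM_seminorms_def)
qed


subsection \<open>The equivalences\<close>

lemma powers_weighted_bounded_if_OM_bounded:
  assumes "vbounded OM_topology {\<lambda>x. h x ^ k |k. 1 \<le> k}"
  shows "powers_weighted_bounded h"
  unfolding powers_weighted_bounded_def
proof (intro allI impI)
  interpret OM: seminormed OM_space "\<Union>m\<in>{1..}. OM_seminorms m" by (rule seminormed_OM)
  fix m v assume v: "rapidly_decreasing v"
  have B: "{\<lambda>x. h x ^ k |k. 1 \<le> k} \<subseteq> OM_space"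
    "\<forall>p\<in>(\<Union>m\<in>{1..}. OM_seminorms m). bdd_above (p ` {\<lambda>x. h x ^ k |k. 1 \<le> k})"
    using assms OM.vbounded_subset OM.vbounded_bdd_above unfolding OM_topology_eq by auto
  \<comment> \<open>\<open>m\<close> may be 0, while the seminorms of \<open>OM_space\<close> come
    from orders at least 1; \<open>Suc m\<close> also controls the lower orders.\<close>
  have "weighted_sup v (Suc m) \<in> (\<Union>m\<in>{1..}. OM_seminorms m)"
    using weighted_sup_in_OM_seminorms(1)[OF v] by (intro UN_I[of "Suc m"]) auto
  then obtain C where C: "\<And>k. k \<ge> 1 \<Longrightarrow> weighted_sup v (Suc m) (\<lambda>x. h x ^ k) \<le> C"
    using B(2) unfolding bdd_above_def by blast
  have "v x * cmod (nth_derivative i (\<lambda>x. h x ^ k) x) \<le> C" if "k \<ge> 1" "i \<le> m" for k i x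
  proof -
    have "(\<lambda>x. h x ^ k) \<in> OM_space" using B(1) that(1) by blast
    then obtain n where "(\<lambda>x. h x ^ k) \<in> OM_step (Suc m) n"
      using OM_space_subset[of "Suc m"] by auto
    then have "weighted_finite v (Suc m) (\<lambda>x. h x ^ k)"
      using weighted_sup_in_OM_seminorms(2)[OF v] by (auto simp: weighted_space_def)
    then have "v x * cmod (nth_derivative i (\<lambda>x. h x ^ k) x) \<le> weighted_sup v (Suc m) (\<lambda>x. h x ^ k)"
      using that(2) by (intro weighted_sup_upper) auto
    then show ?thesis using C[OF that(1)] by linarith
  qed
  then show "\<exists>C. \<forall>k\<ge>1. \<forall>i\<le>m. \<forall>x. v x * cmod (nth_derivative i (\<lambda>x. h x ^ k) x) \<le> C" by blast
qed

text \<open>A set bounded in the norm of one step is bounded for each seminorm of the limit, by the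
  continuity condition imposed on these seminorms.\<close>

lemma OM_bounded_if_powers_step_bounded:
  assumes "powers_step_bounded h"
  shows "vbounded OM_topology {\<lambda>x. h x ^ k |k. 1 \<le> k}"
proof -
  interpret OM: seminormed OM_space "\<Union>m\<in>{1..}. OM_seminorms m" by (rule seminormed_OM)
  have "bdd_above (p ` {\<lambda>x. h x ^ k |k. 1 \<le> k})" if m: "m \<ge> 1" and p: "p \<in> OM_seminorms m" for m p
  proof -
    obtain n C where n: "n \<ge> 1" and C: "\<And>k. k \<ge> 1 \<Longrightarrow> (\<lambda>x. h x ^ k) \<in> OM_step m n"
      "\<And>k. k \<ge> 1 \<Longrightarrow> OM_norm m n (\<lambda>x. h x ^ k) \<le> C"
      using powers_step_boundedE[OF assms m] by metis
    obtain K where K: "\<And>f. f \<in> OM_step m n \<Longrightarrow> p f \<le> K * OM_norm m n f"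
      using OM_seminorms_le[OF p n] by blast
    have "p (\<lambda>x. h x ^ k) \<le> \<bar>K\<bar> * C" if k: "k \<ge> 1" for k
    proof -
      have "p (\<lambda>x. h x ^ k) \<le> K * OM_norm m n (\<lambda>x. h x ^ k)" using K C(1) k by blast
      also have "\<dots> \<le> \<bar>K\<bar> * C"
        using C(2)[OF k] OM_norm_nonneg[OF C(1)[OF k]] by (intro mult_mono) auto
      finally show ?thesis .
    qed
    then show ?thesis by (auto intro!: bdd_aboveI[of _ "\<bar>K\<bar> * C"])
  qed
  moreover have "(\<lambda>x. h x ^ k) \<in> OM_space" if "k \<ge> 1" for k
    using assms that unfolding OM_space_eq powers_step_bounded_def by blast
  ultimately show ?thesis
    unfolding OM_topology_eq OM.vbounded_iff by (intro conjI ballI) auto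
qed

lemma schwartz_power_bounded_if_powers_step_bounded:
  assumes h: "h \<in> OM_space" and bounded: "powers_step_bounded h"
  shows "power_bounded schwartz_topology (mult_operator h)"
proof -
  interpret S: seminormed schwartz_space "{weighted_sup (\<lambda>x. (1 + x\<^sup>2) ^ n) n |n. True}"
    by (rule seminormed_schwartz)
  show ?thesis
    unfolding schwartz_topology_def
  proof (rule S.power_boundedI)
    fix f assume "f \<in> schwartz_space"
    then show "mult_operator h f \<in> schwartz_space"
      unfolding mult_operator_def using schwartz_times_OM h by blast
  next
    fix p assume "p \<in> {weighted_sup (\<lambda>x. (1 + x\<^sup>2) ^ n) n |n. True}"
    then obtain m where p: "p = weighted_sup (\<lambda>x. (1 + x\<^sup>2) ^ m) m" by blast
    \<comment> \<open>Estimate (b) starts at order 1 and \<open>m\<close> may be 0. The passage to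
      \<open>Suc m\<close> is undone by monotonicity of the weighted norms.\<close>
    obtain n C where C: "\<And>k. k \<ge> 1 \<Longrightarrow> (\<lambda>x. h x ^ k) \<in> OM_step (Suc m) n"
      "\<And>k. k \<ge> 1 \<Longrightarrow> OM_norm (Suc m) n (\<lambda>x. h x ^ k) \<le> C"
      using powers_step_boundedE[OF bounded, of "Suc m"] by (metis Suc_le_mono le0 One_nat_def)
    define q where "q = weighted_sup (\<lambda>x. (1 + x\<^sup>2) ^ (Suc m + n)) (Suc m + n)"
    have q: "q \<in> {weighted_sup (\<lambda>x. (1 + x\<^sup>2) ^ n) n |n. True}" unfolding q_def by blast
    have "p ((mult_operator h ^^ k) f) \<le> 2 ^ Suc m * C * q f"
      if k: "k \<ge> 1" and f: "f \<in> schwartz_space" for k f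
    proof -
      note prod = schwartz_mult[OF C(1)[OF k] f]
      have "p ((mult_operator h ^^ k) f)
          \<le> weighted_sup (\<lambda>x. (1 + x\<^sup>2) ^ Suc m) (Suc m) (\<lambda>x. h x ^ k * f x)"
        unfolding p mult_operator_funpow
        by (rule weighted_space_mono(2)[OF _ _ _ prod(1)]) (auto intro!: power_increasing simp del: power_Suc)
      also have "\<dots> \<le> 2 ^ Suc m * (OM_norm (Suc m) n (\<lambda>x. h x ^ k) * q f)"
        unfolding q_def by (rule prod(2))
      also have "\<dots> \<le> 2 ^ Suc m * (C * q f)"
        using C(2)[OF k] S.nonneg[OF q f] by (intro mult_left_mono mult_right_mono) auto
      finally show ?thesis by (simp only: mult.assoc)
    qed
    then show "\<exists>q\<in>{weighted_sup (\<lambda>x. (1 + x\<^sup>2) ^ n) n |n. True}. \<exists>C. \<forall>k\<ge>1. \<forall>f\<in>schwartz_space.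
        p ((mult_operator h ^^ k) f) \<le> C * q f"
      using q by (intro bexI[of _ q] exI[of _ "2 ^ Suc m * C"]) auto
  qed (rule mult_operator_add mult_operator_cscale)+
qed

lemma OM_power_bounded_if_powers_step_bounded:
  assumes h: "h \<in> OM_space" and bounded: "powers_step_bounded h"
  shows "power_bounded OM_topology (mult_operator h)"
proof -
  interpret OM: seminormed OM_space "\<Union>m\<in>{1..}. OM_seminorms m" by (rule seminormed_OM)
  show ?thesis
    unfolding OM_topology_eq
  proof (rule OM.power_boundedI)
    fix f assume "f \<in> OM_space"
    then show "mult_operator h f \<in> OM_space"
      unfolding mult_operator_def using OM_times_OM h by blast
  next
    fix p assume "p \<in> (\<Union>m\<in>{1..}. OM_seminorms m)"
    then obtain m where m: "m \<ge> 1" and p: "p \<in> OM_seminorms m" by auto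
    obtain n C where n: "n \<ge> 1" and C: "\<And>k. k \<ge> 1 \<Longrightarrow> (\<lambda>x. h x ^ k) \<in> OM_step m n"
      "\<And>k. k \<ge> 1 \<Longrightarrow> OM_norm m n (\<lambda>x. h x ^ k) \<le> C"
      using powers_step_boundedE[OF bounded m] by metis
    interpret step: seminormed "\<Union>n\<in>{1..}. OM_step m n" "OM_seminorms m"
      by (rule seminormed_OM_step_limit)
    define E where "E = (\<Union>n\<in>{1..}. OM_step m n)"
    \<comment> \<open>Multiplying by a power of \<open>h\<close> moves step \<open>l\<close> into
      step \<open>n + l\<close> at a cost independent of \<open>k\<close>, as all powers share the
      step \<open>n\<close>.\<close>
    have bound: "\<exists>K. \<forall>f\<in>OM_step m l. \<forall>k\<ge>1. p (\<lambda>x. h x ^ k * f x) \<le> K * OM_norm m l f" if "l \<ge> 1" for l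
    proof -
      obtain K where K: "\<And>f. f \<in> OM_step m (n + l) \<Longrightarrow> p f \<le> K * OM_norm m (n + l) f"
        using OM_seminorms_le[OF p trans_le_add1[OF n]] by blast
      have "p (\<lambda>x. h x ^ k * f x) \<le> \<bar>K\<bar> * (2 ^ m * C) * OM_norm m l f"
        if k: "k \<ge> 1" and f: "f \<in> OM_step m l" for k f
      proof -
        note prod = OM_step_mult[OF C(1)[OF k] f]
        have "p (\<lambda>x. h x ^ k * f x) \<le> K * OM_norm m (n + l) (\<lambda>x. h x ^ k * f x)"
          by (rule K[OF prod(1)])
        also have "\<dots> \<le> \<bar>K\<bar> * OM_norm m (n + l) (\<lambda>x. h x ^ k * f x)"
          using OM_norm_nonneg[OF prod(1)] by (intro mult_right_mono) auto
        also have "\<dots> \<le> \<bar>K\<bar> * (2 ^ m * (OM_norm m n (\<lambda>x. h x ^ k) * OM_norm m l f))"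
          by (intro mult_left_mono prod(2)) auto
        also have "\<dots> \<le> \<bar>K\<bar> * (2 ^ m * (C * OM_norm m l f))"
          using OM_norm_nonneg[OF f] C(2)[OF k] by (intro mult_left_mono mult_right_mono) auto
        finally show ?thesis by (simp only: mult.assoc)
      qed
      then show ?thesis by blast
    qed
    have bdd: "bdd_above ((\<lambda>k. p (\<lambda>x. h x ^ k * f x)) ` {1..})" if f: "f \<in> E" for f
    proof -
      obtain l where l: "l \<ge> 1" "f \<in> OM_step m l" using f by (auto simp: E_def)
      with bound[OF l(1)] obtain K where "\<And>k. k \<ge> 1 \<Longrightarrow> p (\<lambda>x. h x ^ k * f x) \<le> K * OM_norm m l f"
        by blast
      then show ?thesis by (auto intro!: bdd_aboveI[of _ "K * OM_norm m l f"])
    qed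
    have mult_in: "(\<lambda>x. h x ^ k * f x) \<in> E" if f: "f \<in> E" and k: "k \<ge> 1" for f k
    proof -
      obtain l where l: "l \<ge> 1" "f \<in> OM_step m l" using f by (auto simp: E_def)
      have "(\<lambda>x. h x ^ k * f x) \<in> OM_step m (n + l)" by (rule OM_step_mult(1)[OF C(1)[OF k] l(2)])
      then show ?thesis unfolding E_def by (rule UN_I[rotated]) (use n in simp)
    qed
    \<comment> \<open>This supremum dominates all iterates with constant 1 by construction;
      \<open>bound\<close> makes it finite and continuous on every step.\<close>
    define q where "q f = (SUP k\<in>{1..}. p (\<lambda>x. h x ^ k * f x))" for f
    have upper: "p (\<lambda>x. h x ^ k * f x) \<le> q f" if "f \<in> E" "k \<ge> 1" for f k
      unfolding q_def using bdd[OF that(1)] that(2) by (intro cSUP_upper) auto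
    have least: "q f \<le> K" if "\<And>k. k \<ge> 1 \<Longrightarrow> p (\<lambda>x. h x ^ k * f x) \<le> K" for f K
      unfolding q_def using that by (intro cSUP_least) auto
    have "seminorm_on E q"
    proof (rule seminorm_onI)
      show "csubspace E" unfolding E_def by (rule csubspace_OM_steps)
    next
      fix f assume f: "f \<in> E"
      have "0 \<le> p (\<lambda>x. h x ^ 1 * f x)"
        using step.nonneg[OF p] mult_in[OF f, of 1] unfolding E_def by blast
      then show "0 \<le> q f" using upper[OF f, of 1] by linarith
      fix c
      show "q (cscale c f) \<le> cmod c * q f"
      proof (rule least)
        fix k :: nat assume k: "k \<ge> 1"
        have "p (\<lambda>x. h x ^ k * cscale c f x) = p (cscale c (\<lambda>x. h x ^ k * f x))"
          by (simp add: cscale_def algebra_simps)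
        also have "\<dots> = cmod c * p (\<lambda>x. h x ^ k * f x)"
          using step.scale[OF p] mult_in[OF f k] unfolding E_def by blast
        finally show "p (\<lambda>x. h x ^ k * cscale c f x) \<le> cmod c * q f"
          using upper[OF f k] by (simp add: mult_left_mono)
      qed
      fix g assume g: "g \<in> E"
      show "q (f + g) \<le> q f + q g"
      proof (rule least)
        fix k :: nat assume k: "k \<ge> 1"
        have "p (\<lambda>x. h x ^ k * (f + g) x) = p ((\<lambda>x. h x ^ k * f x) + (\<lambda>x. h x ^ k * g x))"
          by (simp add: func_plus algebra_simps)
        also have "\<dots> \<le> p (\<lambda>x. h x ^ k * f x) + p (\<lambda>x. h x ^ k * g x)"
          using step.triangle[OF p] mult_in[OF f k] mult_in[OF g k] unfolding E_def by blast
        finally show "p (\<lambda>x. h x ^ k * (f + g) x) \<le> q f + q g"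
          using upper[OF f k] upper[OF g k] by linarith
      qed
    qed
    moreover have "\<exists>K. \<forall>f\<in>OM_step m l. q f \<le> K * OM_norm m l f" if "l \<ge> 1" for l
      using bound[OF that] least by meson
    ultimately have "q \<in> OM_seminorms m" by (simp add: OM_seminorms_def E_def)
    moreover have "p ((mult_operator h ^^ k) f) \<le> 1 * q f" if "k \<ge> 1" "f \<in> OM_space" for k f
      using upper[of f k] that OM_space_subset[OF m] by (auto simp: mult_operator_funpow E_def)
    ultimately show "\<exists>q\<in>(\<Union>m\<in>{1..}. OM_seminorms m). \<exists>C. \<forall>k\<ge>1. \<forall>f\<in>OM_space.
        p ((mult_operator h ^^ k) f) \<le> C * q f"
      using m by (intro bexI[of _ q] exI[of _ 1]) auto
  qed (rule mult_operator_add mult_operator_cscale)+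
qed

section \<open>From the strong duals back to the powers of \<open>h\<close>\<close>

lemma powers_weighted_bounded_if_OM_dual:
  assumes h: "h \<in> OM_space"
    and dual: "power_bounded (strong_dual OM_topology) (transpose_operator OM_topology (mult_operator h))"
  shows "powers_weighted_bounded h"
  unfolding powers_weighted_bounded_def
proof (intro allI impI)
  interpret OM: seminormed OM_space "\<Union>m\<in>{1..}. OM_seminorms m" by (rule seminormed_OM)
  fix m v assume v: "rapidly_decreasing v"
  have v0: "0 \<le> v x" for x using v by (simp add: rapidly_decreasing_def)
  define p where "p = weighted_sup v (Suc m)"
  have p: "p \<in> (\<Union>m\<in>{1..}. OM_seminorms m)"
    unfolding p_def using weighted_sup_in_OM_seminorms(1)[OF v] by (intro UN_I[of "Suc m"]) auto
  \<comment> \<open>The weight sits in the functionals, so one continuous seminorm \<open>p\<close>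
    dominates them all and the family is strongly bounded.\<close>
  define u where "u i x f = (if f \<in> OM_space then complex_of_real (v x) * nth_derivative i f x else 0)"
    for i x f
  have u_le: "cmod (u i x f) \<le> p f" if f: "f \<in> OM_space" and i: "i \<le> m" for i x f
  proof -
    obtain n where "f \<in> OM_step (Suc m) n" using f OM_space_subset[of "Suc m"] by auto
    then have "weighted_finite v (Suc m) f"
      using weighted_sup_in_OM_seminorms(2)[OF v] by (auto simp: weighted_space_def)
    then have "v x * cmod (nth_derivative i f x) \<le> p f"
      unfolding p_def using i by (intro weighted_sup_upper) auto
    then show ?thesis using f v0 by (simp add: u_def norm_mult)
  qed
  have "\<exists>C. \<forall>k\<ge>1. \<forall>w\<in>{u i x |i x. i \<le> m}. \<forall>f\<in>{\<lambda>x. 1}. cmod (w ((mult_operator h ^^ k) f)) \<le> C"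
  proof (rule OM.transpose_orbit_bounded[OF dual[unfolded OM_topology_eq]])
    show "mult_operator h f \<in> OM_space" if "f \<in> OM_space" for f
      unfolding mult_operator_def using OM_times_OM h that by blast
    show "{u i x |i x. i \<le> m} \<subseteq> continuous_dual OM.X"
    proof (safe, rule OM.continuous_dualI[OF _ _ _ p, where C=1])
      fix i x and f g :: "real \<Rightarrow> complex" and c
      show "f \<notin> OM_space \<Longrightarrow> u i x f = 0" by (simp add: u_def)
      assume i: "i \<le> m" and f: "f \<in> OM_space"
      show "cmod (u i x f) \<le> 1 * p f" using u_le[OF f i] by simp
      show "u i x (cscale c f) = c * u i x f"
        using f OM.scale_in[OF f] Ck_fun_cmult(2)[OF Ck_fun_OM[OF f, of i], of i c x]
        by (simp add: u_def cscale_def)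
      assume g: "g \<in> OM_space"
      show "u i x (f + g) = u i x f + u i x g"
        using f g OM.add_in[OF f g] Ck_fun_add(2)[OF Ck_fun_OM[OF f, of i] Ck_fun_OM[OF g], of i x]
        by (simp add: u_def func_plus distrib_left)
    qed
    show "\<exists>C. \<forall>w\<in>{u i x |i x. i \<le> m}. \<forall>f\<in>B. cmod (w f) \<le> C" if B: "vbounded OM.X B" for B
    proof -
      have BE: "B \<subseteq> OM_space" and "bdd_above (p ` B)"
        using OM.vbounded_subset[OF B] OM.vbounded_bdd_above[OF B p] .
      then obtain C where "\<And>f. f \<in> B \<Longrightarrow> p f \<le> C" unfolding bdd_above_def by blast
      then have "cmod (u i x f) \<le> C" if "i \<le> m" "f \<in> B" for i x f
        using u_le[of f i x] that BE by force
      then show ?thesis by blast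
    qed
    show "vbounded OM.X {\<lambda>x. 1}"
      unfolding OM.vbounded_iff using one_in_OM_space by (intro conjI ballI) simp_all
  qed
  then obtain C where orbit: "\<And>k w. k \<ge> 1 \<Longrightarrow> w \<in> {u i x |i x. i \<le> m} \<Longrightarrow>
      cmod (w ((mult_operator h ^^ k) (\<lambda>x. 1))) \<le> C"
    by blast
  have C: "cmod (u i x (\<lambda>x. h x ^ k)) \<le> C" if "k \<ge> 1" "i \<le> m" for k i x
    using orbit[OF that(1), of "u i x"] that(2) by (auto simp: mult_operator_funpow)
  \<comment> \<open>Outside \<open>OM_space\<close> the functionals are 0, so the derivatives can be
    recovered only after membership of the powers is known.\<close>
  have power_in: "(\<lambda>x. h x ^ k) \<in> OM_space" for k
  proof (induction k)
    case (Suc k)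
    then show ?case using OM_times_OM[OF h] by simp
  qed (simp add: one_in_OM_space)
  have "v x * cmod (nth_derivative i (\<lambda>x. h x ^ k) x) \<le> C" if "k \<ge> 1" "i \<le> m" for k i x
    using C[OF that, of x] power_in v0 by (simp add: u_def norm_mult)
  then show "\<exists>C. \<forall>k\<ge>1. \<forall>i\<le>m. \<forall>x. v x * cmod (nth_derivative i (\<lambda>x. h x ^ k) x) \<le> C" by blast
qed

text \<open>The decay of \<open>v\<close> pays for the distance of the centre \<open>y\<close> from
  the origin, that of the Gaussian for the distance of \<open>x\<close> from the centre. The
  weighted translates thus form a bounded set of Schwartz functions.\<close>

lemma shifted_gauss_bounded:
  assumes v: "rapidly_decreasing v"
  shows "\<exists>C. \<forall>y. \<forall>i\<le>n. \<forall>x. (1 + x\<^sup>2) ^ n *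
    cmod (nth_derivative i (\<lambda>x. complex_of_real (v y) * poly_gauss (-1) 1 (x - y)) x) \<le> C"
proof -
  have v0: "0 \<le> v x" for x using v by (simp add: rapidly_decreasing_def)
  obtain A where A: "\<And>y. v y * (1 + y\<^sup>2) ^ n \<le> A" using v unfolding rapidly_decreasing_def by metis
  have A0: "0 \<le> A" using order_trans[OF _ A[of 0]] v0 by simp
  obtain K where K: "\<And>i t. (1 + t\<^sup>2) ^ n * cmod (nth_derivative i (poly_gauss (-1) 1) t) \<le> K i"
    using gauss_rapidly_decreasing by metis
  have K0: "0 \<le> K i" for i using order_trans[OF _ K[where t=0 and i=i]] by simp
  have "(1 + x\<^sup>2) ^ n * cmod (nth_derivative i (\<lambda>x. complex_of_real (v y) * poly_gauss (-1) 1 (x - y)) x)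
      \<le> 2 ^ n * (A * (\<Sum>i\<le>n. K i))" if i: "i \<le> n" for x y i
  proof -
    \<comment> \<open>In the inequality that follows, right side minus left side equals
      \<open>1 + (x - 2 * y)^2 + 2 * y^2 * (x - y)^2\<close>.\<close>
    have "0 \<le> (x - 2 * y)\<^sup>2" "0 \<le> (x - y)\<^sup>2" "0 \<le> y\<^sup>2 * (x - y)\<^sup>2" by simp_all
    then have "1 + x\<^sup>2 \<le> 2 * ((1 + y\<^sup>2) * (1 + (x - y)\<^sup>2))"
      by (simp add: power2_eq_square algebra_simps)
    then have "(1 + x\<^sup>2) ^ n \<le> (2 * ((1 + y\<^sup>2) * (1 + (x - y)\<^sup>2))) ^ n"
      by (intro power_mono) auto
    then have "(1 + x\<^sup>2) ^ n \<le> 2 ^ n * ((1 + y\<^sup>2) ^ n * (1 + (x - y)\<^sup>2) ^ n)"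
      by (simp only: power_mult_distrib)
    then have "(1 + x\<^sup>2) ^ n * (v y * cmod (nth_derivative i (poly_gauss (-1) 1) (x - y)))
        \<le> (2 ^ n * ((1 + y\<^sup>2) ^ n * (1 + (x - y)\<^sup>2) ^ n))
          * (v y * cmod (nth_derivative i (poly_gauss (-1) 1) (x - y)))"
      using v0 by (intro mult_right_mono) auto
    also have "\<dots> = 2 ^ n * ((v y * (1 + y\<^sup>2) ^ n) *
        ((1 + (x - y)\<^sup>2) ^ n * cmod (nth_derivative i (poly_gauss (-1) 1) (x - y))))"
      by (simp only: mult_ac)
    also have "\<dots> \<le> 2 ^ n * (A * K i)"
      by (intro mult_left_mono mult_mono A K) (auto simp: A0)
    also have "\<dots> \<le> 2 ^ n * (A * (\<Sum>i\<le>n. K i))"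
      using i K0 A0 by (intro mult_left_mono member_le_sum) auto
    finally show ?thesis
      using Ck_fun_cmult_shift(2)[OF Ck_fun_poly_gauss, of i i "complex_of_real (v y)" "-1" 1 y x] v0
      by (simp add: norm_mult)
  qed
  then show ?thesis by blast
qed

text \<open>
  The orbits of the derivatives of point masses are evaluated at \<open>v y\<close> times the Gaussian
  centred at \<open>y\<close>; the Gaussian is then divided out at its centre, where its inverse
  has derivatives independent of \<open>y\<close>.
\<close>

lemma powers_weighted_bounded_if_schwartz_dual:
  assumes h: "h \<in> OM_space"
    and dual: "power_bounded (strong_dual schwartz_topology)
      (transpose_operator schwartz_topology (mult_operator h))"
  shows "powers_weighted_bounded h"
  unfolding powers_weighted_bounded_def
proof (intro allI impI)
  interpret S: seminormed schwartz_space "{weighted_sup (\<lambda>x. (1 + x\<^sup>2) ^ n) n |n. True}"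
    by (rule seminormed_schwartz)
  fix m v assume v: "rapidly_decreasing v"
  have v0: "0 \<le> v x" for x using v by (simp add: rapidly_decreasing_def)
  define p where "p = weighted_sup (\<lambda>x. (1 + x\<^sup>2) ^ m) m"
  have p: "p \<in> {weighted_sup (\<lambda>x. (1 + x\<^sup>2) ^ n) n |n. True}" by (auto simp: p_def)
  \<comment> \<open>These functionals carry no weight: one Schwartz norm bounds the derivatives
    uniformly in \<open>x\<close>. The weight sits in the test functions \<open>G y\<close>
    instead.\<close>
  define u where "u i x f = (if f \<in> schwartz_space then nth_derivative i f x else 0)"
    for i :: nat and x f
  define G where "G y x = complex_of_real (v y) * poly_gauss (-1) 1 (x - y)" for y x
  have Ck: "Ck_fun k f" if "f \<in> schwartz_space" for k f
    using that by (simp add: schwartz_space_def smooth_fun_def)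
  have u_le: "cmod (u i x f) \<le> p f" if f: "f \<in> schwartz_space" and i: "i \<le> m" for i x f
  proof -
    have "cmod (nth_derivative i f x) \<le> (1 + x\<^sup>2) ^ m * cmod (nth_derivative i f x)"
      using mult_right_mono[OF one_le_power[OF one_plus_square_ge_1[of x], of m]
          norm_ge_zero[of "nth_derivative i f x"]] by simp
    also have "\<dots> \<le> p f"
      unfolding p_def using f i by (intro weighted_sup_upper) (auto simp: schwartz_space_def)
    finally show ?thesis using f by (simp add: u_def)
  qed
  have G_Ck: "Ck_fun k (G y)" for k y
    unfolding G_def by (intro Ck_fun_cmult_shift(1) Ck_fun_poly_gauss)
  have G_bounded: "\<exists>C. \<forall>y. \<forall>i\<le>n. \<forall>x. (1 + x\<^sup>2) ^ n * cmod (nth_derivative i (G y) x) \<le> C" for n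
    unfolding G_def by (rule shifted_gauss_bounded[OF v])
  have G_in: "G y \<in> schwartz_space" for y
    using G_Ck G_bounded by (simp add: schwartz_space_def smooth_fun_def weighted_finite_iff) meson
  have "\<exists>C. \<forall>k\<ge>1. \<forall>w\<in>{u i x |i x. i \<le> m}. \<forall>f\<in>range G. cmod (w ((mult_operator h ^^ k) f)) \<le> C"
  proof (rule S.transpose_orbit_bounded[OF dual[unfolded schwartz_topology_def]])
    show "mult_operator h f \<in> schwartz_space" if "f \<in> schwartz_space" for f
      unfolding mult_operator_def using schwartz_times_OM h that by blast
    show "{u i x |i x. i \<le> m} \<subseteq> continuous_dual S.X"
    proof (safe, rule S.continuous_dualI[OF _ _ _ p, where C=1])
      fix i x and f g :: "real \<Rightarrow> complex" and c
      show "f \<notin> schwartz_space \<Longrightarrow> u i x f = 0" by (simp add: u_def)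
      assume i: "i \<le> m" and f: "f \<in> schwartz_space"
      show "cmod (u i x f) \<le> 1 * p f" using u_le[OF f i] by simp
      show "u i x (cscale c f) = c * u i x f"
        using f S.scale_in[OF f] Ck_fun_cmult(2)[OF Ck[OF f, of i], of i c x]
        by (simp add: u_def cscale_def)
      assume g: "g \<in> schwartz_space"
      show "u i x (f + g) = u i x f + u i x g"
        using f g S.add_in[OF f g] Ck_fun_add(2)[OF Ck[OF f, of i] Ck[OF g], of i x]
        by (simp add: u_def func_plus)
    qed
    show "\<exists>C. \<forall>w\<in>{u i x |i x. i \<le> m}. \<forall>f\<in>B. cmod (w f) \<le> C" if B: "vbounded S.X B" for B
    proof -
      have BE: "B \<subseteq> schwartz_space" and "bdd_above (p ` B)"
        using S.vbounded_subset[OF B] S.vbounded_bdd_above[OF B p] .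
      then obtain C where "\<And>f. f \<in> B \<Longrightarrow> p f \<le> C" unfolding bdd_above_def by blast
      then have "cmod (u i x f) \<le> C" if "i \<le> m" "f \<in> B" for i x f
        using u_le[of f i x] that BE by force
      then show ?thesis by blast
    qed
    have "bdd_above (weighted_sup (\<lambda>x. (1 + x\<^sup>2) ^ n) n ` range G)" for n
    proof -
      obtain C where "\<And>y i x. i \<le> n \<Longrightarrow> (1 + x\<^sup>2) ^ n * cmod (nth_derivative i (G y) x) \<le> C"
        using G_bounded by blast
      then have "weighted_sup (\<lambda>x. (1 + x\<^sup>2) ^ n) n (G y) \<le> C" for y
        by (intro weighted_sup_least)
      then show ?thesis by (auto intro!: bdd_aboveI[of _ C])
    qed
    then show "vbounded S.X (range G)"
      unfolding S.vbounded_iff using G_in by (intro conjI ballI) auto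
  qed
  \<comment> \<open>The bound is uniform in both the point \<open>x\<close> and the centre
    \<open>y\<close>; below it is applied on the diagonal \<open>x = y\<close>.\<close>
  then obtain C where C: "\<And>k i x y. k \<ge> 1 \<Longrightarrow> i \<le> m \<Longrightarrow> cmod (u i x (\<lambda>x. h x ^ k * G y x)) \<le> C"
    unfolding mult_operator_funpow by blast
  have hG_in: "(\<lambda>x. h x ^ k * G y x) \<in> schwartz_space" for k y
  proof (induction k)
    case (Suc k)
    then show ?case using schwartz_times_OM[OF h] by (simp add: mult.assoc)
  qed (simp add: G_in)
  define b where "b = (\<Sum>i\<le>m. cmod (nth_derivative i (poly_gauss 1 1) 0))"
  have C0: "0 \<le> C" using order_trans[OF norm_ge_zero C[of 1 0]] by simp
  have b0: "0 \<le> b" by (simp add: b_def sum_nonneg)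
  have "v y * cmod (nth_derivative i (\<lambda>x. h x ^ k) y) \<le> 2 ^ m * (C * b)"
    if k: "k \<ge> 1" and i: "i \<le> m" for k i y
  proof -
    define H where "H x = poly_gauss 1 1 (x - y)" for x
    have H: "Ck_fun m H" and H_deriv: "nth_derivative j H y = nth_derivative j (poly_gauss 1 1) 0" if "j \<le> m" for j
      unfolding H_def using Ck_fun_cmult_shift(1)[OF Ck_fun_poly_gauss[of m 1 1], of 1 y]
        Ck_fun_cmult_shift(2)[OF Ck_fun_poly_gauss[of m 1 1], of j 1 y y] that by auto
    have GH: "G y x * H x = complex_of_real (v y)" for x
      by (simp add: G_def H_def poly_gauss_def exp_minus flip: of_real_mult)
    \<comment> \<open>The product bound is pointwise, so it can be applied at \<open>y\<close> alone
      although \<open>H\<close> grows rapidly away from \<open>y\<close>.\<close>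
    have "cmod (nth_derivative i (\<lambda>x. (h x ^ k * G y x) * H x) y) \<le> 2 ^ i * (C * b)"
    proof (rule cmod_nth_derivative_mult_le[OF Ck[OF hG_in] H i])
      fix j assume j: "j \<le> i"
      show "cmod (nth_derivative j (\<lambda>x. h x ^ k * G y x) y) \<le> C"
        using C[OF k, of j y y] hG_in i j by (simp add: u_def)
      have "cmod (nth_derivative j (poly_gauss 1 1) 0) \<le> b"
        unfolding b_def using i j by (intro member_le_sum) auto
      then show "cmod (nth_derivative j H y) \<le> b" using H_deriv i j by simp
    qed (rule le0)
    moreover have "(\<lambda>x. (h x ^ k * G y x) * H x) = (\<lambda>x. complex_of_real (v y) * h x ^ k)"
      by (simp add: mult.assoc GH mult.commute[of "complex_of_real (v y)"])
    moreover have "nth_derivative i (\<lambda>x. complex_of_real (v y) * h x ^ k) y =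
        complex_of_real (v y) * nth_derivative i (\<lambda>x. h x ^ k) y"
      using Ck_fun_power[OF Ck_fun_OM[OF h]] by (intro Ck_fun_cmult(2)[of i]) auto
    moreover have "(2::real) ^ i * (C * b) \<le> 2 ^ m * (C * b)"
      using i C0 b0 by (intro mult_right_mono power_increasing) auto
    ultimately show ?thesis using v0 by (simp add: norm_mult)
  qed
  then show "\<exists>C. \<forall>k\<ge>1. \<forall>i\<le>m. \<forall>x. v x * cmod (nth_derivative i (\<lambda>x. h x ^ k) x) \<le> C" by blast
qed

theorem theorem4p1:
  fixes h :: "real \<Rightarrow> complex"
  assumes "h \<in> OM_space"
  shows "(power_bounded schwartz_topology (mult_operator h) \<longleftrightarrow>
          power_bounded (strong_dual schwartz_topology)
            (transpose_operator schwartz_topology (mult_operator h)))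
       \<and> (power_bounded schwartz_topology (mult_operator h) \<longleftrightarrow>
          power_bounded OM_topology (mult_operator h))
       \<and> (power_bounded schwartz_topology (mult_operator h) \<longleftrightarrow>
          power_bounded (strong_dual OM_topology)
            (transpose_operator OM_topology (mult_operator h)))
       \<and> (power_bounded schwartz_topology (mult_operator h) \<longleftrightarrow>
          vbounded OM_topology {\<lambda>x. h x ^ n |n. 1 \<le> n})"
proof -
  interpret S: seminormed schwartz_space "{weighted_sup (\<lambda>x. (1 + x\<^sup>2) ^ n) n |n. True}"
    by (rule seminormed_schwartz)
  interpret OM: seminormed OM_space "\<Union>m\<in>{1..}. OM_seminorms m" by (rule seminormed_OM)
  \<comment> \<open>The implications close up: (b) yields both operator statements and the
    boundedness of the powers; each operator statement passes to its dual; the two dual statements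
    and the bounded powers each give (a), hence (b).\<close>
  note dual_S = S.power_bounded_transpose[folded schwartz_topology_def]
  note dual_OM = OM.power_bounded_transpose[folded OM_topology_eq]
  note step = powers_step_bounded_if_weighted_bounded[OF assms]
  show ?thesis
    using dual_S[of "mult_operator h"] dual_OM[of "mult_operator h"] step
      powers_weighted_bounded_if_schwartz_dual[OF assms] powers_weighted_bounded_if_OM_dual[OF assms]
      powers_weighted_bounded_if_OM_bounded[of h] OM_bounded_if_powers_step_bounded[of h]
      schwartz_power_bounded_if_powers_step_bounded[OF assms]
      OM_power_bounded_if_powers_step_bounded[OF assms]
    by blast
qed

end
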